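(* Let $q$ be an offspring distribution with mean $m$ and finite variance. Assume $q_0=0$ and $q_1\ne1$. Then $\mathbf{P}_q$-almost every $\Gamma$ has the property that for every increasing gauge function $f$, $$\mathrm{Cap}_f(\Gamma)>0\quad\text{if and only if}\quad \sum_{n=1}^\infty m^{-n}f(n)<\infty .$$
   Context: For an offspring distribution $q=(q_n)$ with $q_0=0$, $\mathbf{P}_q$ is the Galton-Watson probability measure on infinite rooted trees under which the numbers of children of the vertices are IID, equal to $n$ with probability $q_n$; $m=\sum_n nq_n$. For an infinite rooted tree $\Gamma$, $\partial\Gamma$ is the set of infinite non-self-intersecting paths from the root, and for $x,y\in\partial\Gamma$, $|x\wedge y|$ is the distance from the root of the last common vertex of $x$ and $y$ (infinite if $x=y$). A gauge function $f$ is a positive function on $\{0,1,2,\ldots\}$; it is assumed increasing (in the weak sense), with $f(\infty):=\lim_n f(n)$. The energy of a finite Borel measure $\theta$ on $\partial\Gamma$ is $\mathcal{E}_f(\theta)=\int\int f(|x\wedge y|)\,d\theta(x)\,d\theta(y)$, and $\mathrm{Cap}_f(\Gamma)=\big[\inf\{\mathcal{E}_f(\theta):\theta \text{ a probability measure on }\partial\Gamma\}\big]^{-1}$ (with $1/\infty=0$). *)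

theory Defs
  imports "HOL-Probability.Probability"
begin

section \<open>Rooted trees\<close>

text \<open>
  Locally finite rooted trees are represented by their Ulam--Harris labelling: a vertex is a
  finite word of natural numbers, the root is the empty word, and the children of a vertex
  \<open>v\<close> are \<open>v @ [0], \<dots>, v @ [k - 1]\<close>, where \<open>k\<close> is the number of children
  of \<open>v\<close>.  The distance of a vertex from the root is its length.
\<close>

definition rooted_tree :: "nat list set \<Rightarrow> bool" where
  "rooted_tree \<Gamma> \<longleftrightarrow>
     [] \<in> \<Gamma> \<and>
     (\<forall>v i. v @ [i] \<in> \<Gamma> \<longrightarrow> v \<in> \<Gamma>) \<and>
     (\<forall>v i j. v @ [j] \<in> \<Gamma> \<longrightarrow> i < j \<longrightarrow> v @ [i] \<in> \<Gamma>) \<and>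
     (\<forall>v. finite {i. v @ [i] \<in> \<Gamma>})"

definition num_children :: "nat list set \<Rightarrow> nat list \<Rightarrow> nat" where
  "num_children \<Gamma> v = card {i. v @ [i] \<in> \<Gamma>}"

definition tree_space :: "nat list set measure" where
  "tree_space = sigma {\<Gamma>. rooted_tree \<Gamma>} (range (\<lambda>v. {\<Gamma>. rooted_tree \<Gamma> \<and> v \<in> \<Gamma>}))"


section \<open>The Galton--Watson measure\<close>

definition tree_of_counts :: "(nat list \<Rightarrow> nat) \<Rightarrow> nat list set" where
  "tree_of_counts N = {v. \<forall>k<length v. v ! k < N (take k v)}"

text \<open>
  The family \<open>N\<close> is indexed by all words, not only by the vertices of the resulting tree; the
  values at words outside the tree are irrelevant.  See \<open>num_children_tree_of_counts\<close>.
\<close>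

definition galton_watson :: "nat pmf \<Rightarrow> nat list set measure" where
  "galton_watson q = distr (PiM UNIV (\<lambda>_. measure_pmf q)) tree_space tree_of_counts"

lemma Nil_in_tree_of_counts: "[] \<in> tree_of_counts N"
  by (simp add: tree_of_counts_def)

lemma snoc_in_tree_of_counts:
  "v @ [i] \<in> tree_of_counts N \<longleftrightarrow> v \<in> tree_of_counts N \<and> i < N v"
  by (auto simp: tree_of_counts_def nth_append less_Suc_eq)

lemma rooted_tree_tree_of_counts: "rooted_tree (tree_of_counts N)"
  unfolding rooted_tree_def by (auto simp: Nil_in_tree_of_counts snoc_in_tree_of_counts)

lemma num_children_tree_of_counts:
  "v \<in> tree_of_counts N \<Longrightarrow> num_children (tree_of_counts N) v = N v"
  by (simp add: num_children_def snoc_in_tree_of_counts)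

lemma space_tree_space: "space tree_space = {\<Gamma>. rooted_tree \<Gamma>}"
  unfolding tree_space_def by (rule space_measure_of) auto

lemma measurable_tree_of_counts [measurable]:
  "tree_of_counts \<in> measurable (PiM UNIV (\<lambda>_. measure_pmf q)) tree_space"
  unfolding tree_space_def
proof (rule measurable_measure_of)
  let ?M = "PiM UNIV (\<lambda>_::nat list. measure_pmf q)"
  fix A assume "A \<in> range (\<lambda>v. {\<Gamma>. rooted_tree \<Gamma> \<and> v \<in> \<Gamma>})"
  then obtain v where A: "A = {\<Gamma>. rooted_tree \<Gamma> \<and> v \<in> \<Gamma>}" by auto
  have "{N \<in> space ?M. \<forall>k<length v. v ! k < N (take k v)} \<in> sets ?M"
    by measurable
  also have "{N \<in> space ?M. \<forall>k<length v. v ! k < N (take k v)} = tree_of_counts -` A \<inter> space ?M"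
    using rooted_tree_tree_of_counts by (auto simp: A tree_of_counts_def)
  finally show "tree_of_counts -` A \<inter> space ?M \<in> sets ?M" .
qed (use rooted_tree_tree_of_counts in auto)

lemma prob_space_galton_watson: "prob_space (galton_watson q)"
  unfolding galton_watson_def
  by (intro prob_space.prob_space_distr prob_space_PiM measurable_tree_of_counts
      prob_space_measure_pmf)


section \<open>The boundary of a tree\<close>

definition adjacent :: "nat list \<Rightarrow> nat list \<Rightarrow> bool" where
  "adjacent u v \<longleftrightarrow> (\<exists>i. v = u @ [i]) \<or> (\<exists>i. u = v @ [i])"

definition boundary :: "nat list set \<Rightarrow> (nat \<Rightarrow> nat list) set" where
  "boundary \<Gamma> = {x. x 0 = [] \<and> range x \<subseteq> \<Gamma> \<and> (\<forall>n. adjacent (x n) (x (Suc n))) \<and> inj x}"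

definition meet :: "(nat \<Rightarrow> nat list) \<Rightarrow> (nat \<Rightarrow> nat list) \<Rightarrow> enat" where
  "meet x y = (if x = y then \<infinity> else enat (Max (length ` (range x \<inter> range y))))"

text \<open>
  The usual topology on the boundary, in which the sets of rays through a given vertex form a
  basis, is the one induced by pointwise convergence.
\<close>

definition boundary_topology :: "nat list set \<Rightarrow> (nat \<Rightarrow> nat list) topology" where
  "boundary_topology \<Gamma> =
     subtopology (product_topology (\<lambda>_. discrete_topology UNIV) UNIV) (boundary \<Gamma>)"

definition boundary_borel :: "nat list set \<Rightarrow> (nat \<Rightarrow> nat list) measure" where
  "boundary_borel \<Gamma> = sigma (boundary \<Gamma>) {U. openin (boundary_topology \<Gamma>) U}"


section \<open>Energy and capacity\<close>

definition gauge_function :: "(nat \<Rightarrow> real) \<Rightarrow> bool" where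
  "gauge_function f \<longleftrightarrow> (\<forall>n. 0 < f n)"

definition gauge_ext :: "(nat \<Rightarrow> real) \<Rightarrow> enat \<Rightarrow> ennreal" where
  "gauge_ext f n = (case n of enat k \<Rightarrow> ennreal (f k) | \<infinity> \<Rightarrow> lim (\<lambda>k. ennreal (f k)))"

definition energy :: "(nat \<Rightarrow> real) \<Rightarrow> (nat \<Rightarrow> nat list) measure \<Rightarrow> ennreal" where
  "energy f \<theta> = (\<integral>\<^sup>+ x. (\<integral>\<^sup>+ y. gauge_ext f (meet x y) \<partial>\<theta>) \<partial>\<theta>)"

definition capacity :: "(nat \<Rightarrow> real) \<Rightarrow> nat list set \<Rightarrow> ennreal" where
  "capacity f \<Gamma> =
     inverse (INF \<theta>\<in>{\<theta>. prob_space \<theta> \<and> sets \<theta> = sets (boundary_borel \<Gamma>)}. energy f \<theta>)"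

end

theory Submission
  imports Defs
begin

text \<open>
  Both directions only use the growth of the tree and its limit uniform measure.  Writing
  \<open>d n = f n - f (n - 1)\<close>, the energy of \<open>\<theta>\<close> is
  \<open>\<Sum>n. d n * (\<Sum>|v| = n. \<theta>(v)\<^sup>2)\<close>, and \<open>\<Sum> d n / m ^ n\<close> converges iff
  \<open>\<Sum> f n / m ^ n\<close> does.  Since a.s. the \<open>n\<close>-th level has at most \<open>C m ^ n\<close> vertices,
  Cauchy--Schwarz bounds the inner sum below by \<open>1 / (C m ^ n)\<close>, whatever \<open>\<theta>\<close> is.  Conversely, let
  \<open>W\<close> be the limit of the normalised generation sizes, positive a.s. and square integrable.  Splitting
  mass in proportion to \<open>W\<close> gives the vertex \<open>v\<close> the mass \<open>W(v) / (W m ^ |v|)\<close>, so what is needed is that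
  \<open>m ^ -n (\<Sum>|v| = n. W(v)\<^sup>2)\<close> stays bounded a.s.  This is half of a strong law of large numbers
  for integrable functionals of the subtrees, proved by truncation at \<open>m ^ n\<close>.  The exceptional
  null set does not involve \<open>f\<close>.

  All moments are computed from the first generation: \<open>branch_sum g\<close> sums \<open>g\<close> over the subtrees of the
  children of the root, and its \<open>n\<close>-th iterate sums \<open>g\<close> over the subtrees at level \<open>n\<close>.
\<close>


section \<open>The branching property\<close>

definition subcounts :: "nat \<Rightarrow> (nat list \<Rightarrow> nat) \<Rightarrow> nat list \<Rightarrow> nat" where
  "subcounts i N = (\<lambda>u. N (i # u))"

text \<open>Inverse to splitting counts into the root count and the families
  \<open>subcounts i\<close>. The forest \<open>F\<close> is infinite whatever \<open>k\<close> is,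
  so that root count and subtrees can be independent; the \<open>F i\<close> with i \<ge> k land on
  words outside the tree.\<close>

definition graft :: "nat \<Rightarrow> (nat \<Rightarrow> nat list \<Rightarrow> nat) \<Rightarrow> nat list \<Rightarrow> nat" where
  "graft k F w = (case w of [] \<Rightarrow> k | i # u \<Rightarrow> F i u)"

lemma graft_Nil [simp]: "graft k F [] = k"
  and subcounts_graft [simp]: "subcounts i (graft k F) = F i"
  by (simp_all add: graft_def subcounts_def)

abbreviation counts_measure :: "nat pmf \<Rightarrow> (nat list \<Rightarrow> nat) measure" where
  "counts_measure q \<equiv> PiM UNIV (\<lambda>_. measure_pmf q)"

abbreviation forest_measure :: "nat pmf \<Rightarrow> (nat \<Rightarrow> nat list \<Rightarrow> nat) measure" where
  "forest_measure q \<equiv> PiM UNIV (\<lambda>_. counts_measure q)"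

lemma space_counts_measure [simp]: "space (counts_measure q) = UNIV"
  by (simp add: space_PiM)

lemma space_forest_measure [simp]: "space (forest_measure q) = UNIV"
  by (simp add: space_PiM)

lemma prob_space_counts_measure: "prob_space (counts_measure q)"
  by (intro prob_space_PiM prob_space_measure_pmf)

lemma prob_space_forest_measure: "prob_space (forest_measure q)"
  by (intro prob_space_PiM prob_space_measure_pmf)

lemma measurable_counts_component [measurable]:
  "(\<lambda>N. N v) \<in> counts_measure q \<rightarrow>\<^sub>M count_space UNIV"
proof -
  have "(\<lambda>N. N v) \<in> counts_measure q \<rightarrow>\<^sub>M measure_pmf q"
    by (rule measurable_component_singleton) auto
  then show ?thesis by simp
qed

lemma measurable_into_counts_measure:
  assumes "\<And>v. (\<lambda>x. f x v) \<in> M \<rightarrow>\<^sub>M count_space UNIV"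
  shows "f \<in> M \<rightarrow>\<^sub>M counts_measure q"
proof -
  have "(\<lambda>x. f x) \<in> M \<rightarrow>\<^sub>M counts_measure q"
    by (rule measurable_PiM_single') (use assms in auto)
  then show ?thesis by simp
qed

lemma measurable_forest_component [measurable]:
  "(\<lambda>F. F i) \<in> forest_measure q \<rightarrow>\<^sub>M counts_measure q"
  by (rule measurable_component_singleton) auto

lemma measurable_subcounts [measurable]:
  "subcounts i \<in> counts_measure q \<rightarrow>\<^sub>M counts_measure q"
  unfolding subcounts_def by (rule measurable_into_counts_measure) measurable

lemma measurable_graft [measurable]:
  "(\<lambda>(k, F). graft k F) \<in> measure_pmf q \<Otimes>\<^sub>M forest_measure q \<rightarrow>\<^sub>M counts_measure q"
proof (rule measurable_into_counts_measure)
  fix v :: "nat list"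
  have "(\<lambda>x. snd x i u) \<in> measure_pmf q \<Otimes>\<^sub>M forest_measure q \<rightarrow>\<^sub>M count_space UNIV" for i u
    by (rule measurable_compose[OF measurable_compose[OF measurable_snd measurable_forest_component]
          measurable_counts_component])
  moreover have "fst \<in> measure_pmf q \<Otimes>\<^sub>M forest_measure q \<rightarrow>\<^sub>M count_space UNIV"
    using measurable_fst[of "measure_pmf q" "forest_measure q"] by simp
  ultimately show "(\<lambda>x. (case x of (k, F) \<Rightarrow> graft k F) v)
      \<in> measure_pmf q \<Otimes>\<^sub>M forest_measure q \<rightarrow>\<^sub>M count_space UNIV"
    by (cases v) (simp_all add: graft_def case_prod_beta')
qed

text \<open>The branching property. It suffices to compare finite-dimensional cylinders: a finite
  set \<open>J\<close> of words splits into the root and, for each first letter, the words beginning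
  with it, and the product of the marginal probabilities factorises in the same way.\<close>

lemma distr_graft:
  "distr (measure_pmf q \<Otimes>\<^sub>M forest_measure q) (counts_measure q) (\<lambda>(k, F). graft k F)
     = counts_measure q"  (is "?D = _")
proof (rule measure_eqI_PiM_infinite)
  interpret F: prob_space "forest_measure q" by (rule prob_space_forest_measure)
  interpret pair_prob_space "measure_pmf q" "forest_measure q" ..
  show "finite_measure ?D"
    by (intro finite_measure_distr measurable_graft)
  fix A :: "nat list \<Rightarrow> nat set" and J :: "nat list set"
  assume J: "finite J"
  \<comment> \<open>Padding with \<open>UNIV\<close> gives a condition on every word, so the root
    contributes a factor even when it is not in \<open>J\<close>.\<close>
  define B where "B w = (if w \<in> J then A w else UNIV)" for w
  define H where "H = {i. \<exists>u. i # u \<in> J}"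
  define U where "U i = {u. i # u \<in> J}" for i
  have fH: "finite H"
    by (rule finite_subset[of _ "hd ` J"]) (use J in \<open>force simp: H_def image_iff\<close>)+
  have fU: "finite (U i)" for i
    by (rule finite_subset[of _ "tl ` J"]) (use J in \<open>force simp: U_def image_iff\<close>)+
  have emb: "prod_emb UNIV (\<lambda>_. measure_pmf q) J (Pi\<^sub>E J A) = {N. \<forall>w\<in>J. N w \<in> B w}"
    by (auto simp: prod_emb_def B_def PiE_iff space_PiM)
  have J': "J = (J \<inter> {[]}) \<union> (\<lambda>(i,u). i # u) ` (SIGMA i:H. U i)"
  proof (intro set_eqI)
    fix w show "w \<in> J \<longleftrightarrow> w \<in> (J \<inter> {[]}) \<union> (\<lambda>(i,u). i # u) ` (SIGMA i:H. U i)"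
      by (cases w) (auto simp: H_def U_def image_iff)
  qed
  have prodJ: "(\<Prod>w\<in>J. emeasure q (B w)) = emeasure q (B []) * (\<Prod>i\<in>H. \<Prod>u\<in>U i. emeasure q (B (i # u)))"
  proof -
    have "(\<Prod>w\<in>J. emeasure q (B w)) = (\<Prod>w\<in>J \<inter> {[]}. emeasure q (B w)) *
        (\<Prod>w\<in>(\<lambda>(i,u). i # u) ` (SIGMA i:H. U i). emeasure q (B w))"
      by (subst J', rule prod.union_disjoint) (use fH fU in auto)
    also have "(\<Prod>w\<in>J \<inter> {[]}. emeasure q (B w)) = emeasure q (B [])"
    proof (cases "[] \<in> J")
      case False
      then have "J \<inter> {[]} = {}" by auto
      then show ?thesis using False measure_pmf.emeasure_space_1[of q] by (simp add: B_def)
    qed simp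
    also have "(\<Prod>w\<in>(\<lambda>(i,u). i # u) ` (SIGMA i:H. U i). emeasure q (B w)) =
        (\<Prod>(i,u)\<in>(SIGMA i:H. U i). emeasure q (B (i # u)))"
      by (subst prod.reindex) (auto simp: inj_on_def case_prod_beta')
    also have "\<dots> = (\<Prod>i\<in>H. \<Prod>u\<in>U i. emeasure q (B (i # u)))"
      using fH fU by (subst prod.Sigma) auto
    finally show ?thesis .
  qed
  interpret C: product_prob_space "\<lambda>_::nat list. measure_pmf q" UNIV ..
  interpret FP: product_prob_space "\<lambda>_::nat. counts_measure q" UNIV
    by (intro product_prob_spaceI prob_space_counts_measure)
  have CC: "emeasure (counts_measure q) {N. \<forall>u\<in>K. N u \<in> G u} = (\<Prod>u\<in>K. emeasure q (G u))"
    if "finite K" for K G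
    using C.emeasure_PiM_Collect[of K G] that by simp
  have sC: "{N. \<forall>u\<in>K. N u \<in> G u} \<in> sets (counts_measure q)" if "finite K" for K and G :: "nat list \<Rightarrow> nat set"
  proof -
    have "{N \<in> space (counts_measure q). \<forall>u\<in>K. N u \<in> G u} \<in> sets (counts_measure q)"
      using that by measurable
    then show ?thesis by simp
  qed
  have "emeasure ?D {N. \<forall>w\<in>J. N w \<in> B w} = emeasure (measure_pmf q \<Otimes>\<^sub>M forest_measure q)
      ((\<lambda>(k, F). graft k F) -` {N. \<forall>w\<in>J. N w \<in> B w} \<inter> space (measure_pmf q \<Otimes>\<^sub>M forest_measure q))"
    by (rule emeasure_distr) (use sC J in auto)
  also have "(\<lambda>(k, F). graft k F) -` {N. \<forall>w\<in>J. N w \<in> B w} \<inter> space (measure_pmf q \<Otimes>\<^sub>M forest_measure q)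
      = B [] \<times> {F. \<forall>i\<in>H. F i \<in> {N. \<forall>u\<in>U i. N u \<in> B (i # u)}}"
  proof (intro set_eqI)
    fix x :: "nat \<times> (nat \<Rightarrow> nat list \<Rightarrow> nat)"
    obtain k F where x: "x = (k, F)" by force
    have "(\<forall>w\<in>J. graft k F w \<in> B w) \<longleftrightarrow> (\<forall>w. graft k F w \<in> B w)"
      by (auto simp: B_def)
    also have "\<dots> \<longleftrightarrow> k \<in> B [] \<and> (\<forall>i u. F i u \<in> B (i # u))"
      by (metis graft_Nil graft_def list.case(2) list.exhaust)
    also have "(\<forall>i u. F i u \<in> B (i # u)) \<longleftrightarrow> (\<forall>i\<in>H. \<forall>u\<in>U i. F i u \<in> B (i # u))"
      by (auto simp: B_def H_def U_def)
    finally show "x \<in> (\<lambda>(k, F). graft k F) -` {N. \<forall>w\<in>J. N w \<in> B w} \<inter> space (measure_pmf q \<Otimes>\<^sub>M forest_measure q)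
       \<longleftrightarrow> x \<in> B [] \<times> {F. \<forall>i\<in>H. F i \<in> {N. \<forall>u\<in>U i. N u \<in> B (i # u)}}"
      by (simp add: x space_pair_measure)
  qed
  also have "emeasure (measure_pmf q \<Otimes>\<^sub>M forest_measure q) \<dots> =
      emeasure q (B []) * emeasure (forest_measure q) {F. \<forall>i\<in>H. F i \<in> {N. \<forall>u\<in>U i. N u \<in> B (i # u)}}"
  proof (rule F.emeasure_pair_measure_Times)
    have "{F \<in> space (forest_measure q). \<forall>i\<in>H. F i \<in> {N. \<forall>u\<in>U i. N u \<in> B (i # u)}} \<in> sets (forest_measure q)"
      by (rule sets.sets_Collect_finite_All[OF _ fH])
        (use measurable_sets[OF measurable_forest_component sC[OF fU]] in \<open>auto simp: vimage_def\<close>)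
    then show "{F. \<forall>i\<in>H. F i \<in> {N. \<forall>u\<in>U i. N u \<in> B (i # u)}} \<in> sets (forest_measure q)"
      by simp
  qed simp
  also have "emeasure (forest_measure q) {F. \<forall>i\<in>H. F i \<in> {N. \<forall>u\<in>U i. N u \<in> B (i # u)}} =
      (\<Prod>i\<in>H. \<Prod>u\<in>U i. emeasure q (B (i # u)))"
    using FP.emeasure_PiM_Collect[of H "\<lambda>i. {N. \<forall>u\<in>U i. N u \<in> B (i # u)}"] fH sC[OF fU] CC[OF fU]
    by simp
  also have "emeasure q (B []) * \<dots> = emeasure (counts_measure q) {N. \<forall>w\<in>J. N w \<in> B w}"
    by (simp only: prodJ[symmetric] CC[OF J])
  finally show "emeasure ?D (prod_emb UNIV (\<lambda>_. measure_pmf q) J (Pi\<^sub>E J A)) =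
      emeasure (counts_measure q) (prod_emb UNIV (\<lambda>_. measure_pmf q) J (Pi\<^sub>E J A))"
    by (simp only: emb)
qed simp_all

text \<open>Integration by conditioning on the root count: the form in which the branching property
  is applied.\<close>

lemma nn_integral_counts_measure:
  assumes [measurable]: "f \<in> borel_measurable (counts_measure q)"
  shows "(\<integral>\<^sup>+ N. f N \<partial>counts_measure q) =
    (\<integral>\<^sup>+ k. \<integral>\<^sup>+ F. f (graft k F) \<partial>forest_measure q \<partial>measure_pmf q)"
proof -
  interpret F: prob_space "forest_measure q" by (rule prob_space_forest_measure)
  have "(\<integral>\<^sup>+ N. f N \<partial>counts_measure q) =
      (\<integral>\<^sup>+ x. f (case x of (k, F) \<Rightarrow> graft k F) \<partial>(measure_pmf q \<Otimes>\<^sub>M forest_measure q))"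
    by (subst distr_graft[symmetric], rule nn_integral_distr[OF measurable_graft]) simp
  also have "\<dots> = (\<integral>\<^sup>+ k. \<integral>\<^sup>+ F. f (case (k, F) of (k, F) \<Rightarrow> graft k F) \<partial>forest_measure q \<partial>measure_pmf q)"
    by (rule F.nn_integral_fst[symmetric])
      (rule measurable_compose[OF measurable_graft assms])
  finally show ?thesis by simp
qed

lemma forest_component_distr:
  "distr (forest_measure q) (counts_measure q) (\<lambda>F. F i) = counts_measure q"
  by (rule distr_PiM_component) (auto intro: prob_space_counts_measure)

text \<open>Under \<open>graft\<close>, the i-th subtree is the i-th coordinate of the forest. This
  covers every \<open>i\<close>, child of the root or not, because counts are attached to all
  words.\<close>

lemma distr_subcounts:
  "distr (counts_measure q) (counts_measure q) (subcounts i) = counts_measure q"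
proof (rule measure_eqI)
  fix A assume "A \<in> sets (distr (counts_measure q) (counts_measure q) (subcounts i))"
  then have A [measurable]: "A \<in> sets (counts_measure q)" by simp
  have "emeasure (distr (counts_measure q) (counts_measure q) (subcounts i)) A
      = (\<integral>\<^sup>+ N. indicator A (subcounts i N) \<partial>counts_measure q)"
    by (subst nn_integral_distr[symmetric, of _ _ "counts_measure q"]) auto
  also have "\<dots> = (\<integral>\<^sup>+ k. \<integral>\<^sup>+ F. indicator A (F i) \<partial>forest_measure q \<partial>measure_pmf q)"
    by (subst nn_integral_counts_measure) auto
  also have "(\<integral>\<^sup>+ F. indicator A (F i) \<partial>forest_measure q) = emeasure (counts_measure q) A"
    by (subst nn_integral_distr[symmetric, of "\<lambda>F. F i" _ "counts_measure q"])
      (auto simp: forest_component_distr)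
  finally show "emeasure (distr (counts_measure q) (counts_measure q) (subcounts i)) A
      = emeasure (counts_measure q) A" by simp
qed simp

lemma indep_vars_forest_components:
  "prob_space.indep_vars (forest_measure q) (\<lambda>_. counts_measure q) (\<lambda>i F. F i) UNIV"
proof -
  interpret F: prob_space "forest_measure q" by (rule prob_space_forest_measure)
  have "distr (forest_measure q) (forest_measure q) (\<lambda>F. \<lambda>i\<in>UNIV. F i) = forest_measure q"
    by (simp add: restrict_UNIV distr_id)
  then show ?thesis
    by (subst F.indep_vars_iff_distr_eq_PiM') (simp_all add: forest_component_distr)
qed

section \<open>Sums over the children of the root\<close>

definition branch_sum :: "((nat list \<Rightarrow> nat) \<Rightarrow> 'a::comm_monoid_add) \<Rightarrow> (nat list \<Rightarrow> nat) \<Rightarrow> 'a" where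
  "branch_sum g N = (\<Sum>i<N []. g (subcounts i N))"

lemma branch_sum_graft: "branch_sum g (graft k F) = (\<Sum>i<k. g (F i))"
  by (simp add: branch_sum_def)

text \<open>The number of summands is random but has countably many values, on each of which the sum
  has a fixed length.\<close>

lemma measurable_branch_sum [measurable]:
  fixes g :: "(nat list \<Rightarrow> nat) \<Rightarrow> 'a::{second_countable_topology, topological_comm_monoid_add}"
  assumes g [measurable]: "g \<in> borel_measurable (counts_measure q)"
  shows "branch_sum g \<in> borel_measurable (counts_measure q)"
  unfolding branch_sum_def
proof (rule measurable_compose_countable[where f="\<lambda>k N. \<Sum>i<k. g (subcounts i N)"])
  show "(\<lambda>N. \<Sum>i<k. g (subcounts i N)) \<in> borel_measurable (counts_measure q)" for k
    using measurable_compose[OF measurable_subcounts g] by (intro borel_measurable_sum) auto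
  show "(\<lambda>N. N []) \<in> counts_measure q \<rightarrow>\<^sub>M count_space UNIV" by (rule measurable_counts_component)
qed

lemma measurable_branch_sum_iter [measurable]:
  fixes g :: "(nat list \<Rightarrow> nat) \<Rightarrow> 'a::{second_countable_topology, topological_comm_monoid_add}"
  assumes g [measurable]: "g \<in> borel_measurable (counts_measure q)"
  shows "(branch_sum ^^ n) g \<in> borel_measurable (counts_measure q)"
  by (induction n) auto

lemma nn_integral_forest_component:
  assumes [measurable]: "g \<in> borel_measurable (counts_measure q)"
  shows "(\<integral>\<^sup>+ F. g (F i) \<partial>forest_measure q) = (\<integral>\<^sup>+ N. g N \<partial>counts_measure q)"
  using nn_integral_distr[OF measurable_forest_component[of i q], of g]
  by (simp add: forest_component_distr)

lemma integrable_forest_component: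
  fixes g :: "_ \<Rightarrow> real"
  assumes "integrable (counts_measure q) g"
  shows "integrable (forest_measure q) (\<lambda>F. g (F i))"
  using assms integrable_distr[OF measurable_forest_component[of i q], of g]
  by (simp add: forest_component_distr)

lemma integral_forest_component:
  fixes g :: "_ \<Rightarrow> real"
  assumes "g \<in> borel_measurable (counts_measure q)"
  shows "(\<integral> F. g (F i) \<partial>forest_measure q) = (\<integral> N. g N \<partial>counts_measure q)"
  using integral_distr[OF measurable_forest_component[of i q], of g] assms
  by (simp add: forest_component_distr)

text \<open>Subtrees at different children are independent. This removes the cross terms in second
  moments and produces the square in the inequality for the probability that \<open>W\<close>
  vanishes.\<close>

lemma integral_forest_mult:
  fixes g h :: "_ \<Rightarrow> real"
  assumes "i \<noteq> j"
    and g: "integrable (counts_measure q) g" and h: "integrable (counts_measure q) h"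
  shows "integrable (forest_measure q) (\<lambda>F. g (F i) * h (F j))"
    and "(\<integral> F. g (F i) * h (F j) \<partial>forest_measure q)
      = (\<integral> N. g N \<partial>counts_measure q) * (\<integral> N. h N \<partial>counts_measure q)"
proof -
  interpret F: prob_space "forest_measure q" by (rule prob_space_forest_measure)
  have [measurable]: "g \<in> borel_measurable (counts_measure q)" "h \<in> borel_measurable (counts_measure q)"
    using g h by auto
  define Y where "Y l = (if l = i then g else h)" for l
  have Y: "integrable (counts_measure q) (Y l)" for l
    using g h by (simp add: Y_def)
  have "F.indep_vars (\<lambda>_. counts_measure q) (\<lambda>l F. F l) {i, j}"
    by (rule F.indep_vars_subset[OF indep_vars_forest_components]) simp
  then have ind: "F.indep_vars (\<lambda>_. borel) (\<lambda>l F. Y l (F l)) {i, j}"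
    by (rule F.indep_vars_compose2) (simp add: Y_def)
  have int: "integrable (forest_measure q) (\<lambda>F. Y l (F l))" for l
    using integrable_forest_component[OF Y] .
  have prod: "(\<Prod>l\<in>{i, j}. Y l (F l)) = g (F i) * h (F j)" for F
    using assms(1) by (simp add: Y_def)
  show "integrable (forest_measure q) (\<lambda>F. g (F i) * h (F j))"
    using F.indep_vars_integrable[OF _ ind int] by (simp add: prod)
  have "(\<integral> F. Y l (F l) \<partial>forest_measure q) = (\<integral> N. Y l N \<partial>counts_measure q)" for l
    by (rule integral_forest_component) (simp add: Y_def)
  then have "(\<Prod>l\<in>{i, j}. \<integral> F. Y l (F l) \<partial>forest_measure q)
      = (\<integral> N. g N \<partial>counts_measure q) * (\<integral> N. h N \<partial>counts_measure q)"
    using assms(1) by (simp add: Y_def)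
  then show "(\<integral> F. g (F i) * h (F j) \<partial>forest_measure q)
      = (\<integral> N. g N \<partial>counts_measure q) * (\<integral> N. h N \<partial>counts_measure q)"
    using F.indep_vars_lebesgue_integral[OF _ ind int] by (simp add: prod)
qed

section \<open>Moments of sums over a generation\<close>

locale offspring =
  fixes q :: "nat pmf" and m :: real
  assumes mean_finite: "integrable (measure_pmf q) real"
    and mean: "m = measure_pmf.expectation q real"
    and variance_finite: "integrable (measure_pmf q) (\<lambda>n. (real n - m)\<^sup>2)"
    and q0: "pmf q 0 = 0"
    and q1: "pmf q 1 \<noteq> 1"
begin

abbreviation \<Omega> :: "(nat list \<Rightarrow> nat) measure" where
  "\<Omega> \<equiv> counts_measure q"

sublocale prob_space \<Omega>
  by (rule prob_space_counts_measure)

lemma nn_integral_offspring: "(\<integral>\<^sup>+ k. ennreal (real k) \<partial>measure_pmf q) = ennreal m"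
  using nn_integral_eq_integral[OF mean_finite] mean by simp

lemma offspring_pos: "k \<in> set_pmf q \<Longrightarrow> 1 \<le> k"
  using q0 by (cases k) (auto simp: set_pmf_iff)

text \<open>The variable \<open>real k - 1\<close> is almost surely non-negative with integral
  \<open>m - 1\<close>. If the integral were not positive, it would vanish almost surely and
  \<open>q\<close> would be the point mass at 1.\<close>

lemma mean_gt_1: "1 < m"
proof (rule ccontr)
  assume "\<not> 1 < m"
  have int: "integrable (measure_pmf q) (\<lambda>k. real k - 1)"
    using mean_finite by simp
  have eq: "(\<integral> k. real k - 1 \<partial>measure_pmf q) = m - 1"
    using mean_finite mean by simp
  have nn: "AE k in measure_pmf q. 0 \<le> real k - 1"
    using offspring_pos by (auto simp: AE_measure_pmf_iff)
  have "0 \<le> m - 1" using integral_nonneg_AE[OF nn] eq by simp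
  then have "(\<integral> k. real k - 1 \<partial>measure_pmf q) = 0" using eq \<open>\<not> 1 < m\<close> by simp
  then have "AE k in measure_pmf q. real k - 1 = 0"
    using integral_nonneg_eq_0_iff_AE[OF int nn] by simp
  then have "set_pmf q \<subseteq> {1}" by (auto simp: AE_measure_pmf_iff)
  then have "q = return_pmf 1" by (simp add: set_pmf_subset_singleton)
  then have "pmf q 1 = pmf (return_pmf 1) (1::nat)" by (rule arg_cong)
  then show False using q1 by simp
qed

text \<open>Wald's identity: the root count is independent of the subtrees, each of which has the
  law of the whole tree.\<close>

lemma nn_integral_branch_sum:
  assumes [measurable]: "g \<in> borel_measurable \<Omega>"
  shows "(\<integral>\<^sup>+ N. branch_sum g N \<partial>\<Omega>) = ennreal m * (\<integral>\<^sup>+ N. g N \<partial>\<Omega>)"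
proof -
  have "(\<integral>\<^sup>+ N. branch_sum g N \<partial>\<Omega>)
      = (\<integral>\<^sup>+ k. \<integral>\<^sup>+ F. (\<Sum>i<k. g (F i)) \<partial>forest_measure q \<partial>measure_pmf q)"
    by (subst nn_integral_counts_measure) (simp_all add: branch_sum_graft)
  also have "\<dots> = (\<integral>\<^sup>+ k. ennreal (real k) * (\<integral>\<^sup>+ N. g N \<partial>\<Omega>) \<partial>measure_pmf q)"
    by (intro nn_integral_cong)
      (simp add: nn_integral_sum nn_integral_forest_component ennreal_of_nat_eq_real_of_nat)
  also have "\<dots> = ennreal m * (\<integral>\<^sup>+ N. g N \<partial>\<Omega>)"
    by (subst nn_integral_multc) (simp_all add: nn_integral_offspring)
  finally show ?thesis .
qed

lemma nn_integral_branch_sum_iter: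
  assumes [measurable]: "g \<in> borel_measurable \<Omega>"
  shows "(\<integral>\<^sup>+ N. (branch_sum ^^ n) g N \<partial>\<Omega>) = ennreal m ^ n * (\<integral>\<^sup>+ N. g N \<partial>\<Omega>)"
proof (induction n)
  case (Suc n)
  then show ?case by (simp add: nn_integral_branch_sum[OF measurable_branch_sum_iter[OF assms]] mult.assoc)
qed simp

lemma integrable_branch_sum:
  fixes g :: "_ \<Rightarrow> real"
  assumes g: "integrable \<Omega> g"
  shows "integrable \<Omega> (branch_sum g)"
proof (rule integrableI_bounded)
  have [measurable]: "g \<in> borel_measurable \<Omega>" using g by auto
  then show "branch_sum g \<in> borel_measurable \<Omega>" by measurable
  have "(\<integral>\<^sup>+ N. ennreal (norm (branch_sum g N)) \<partial>\<Omega>)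
      \<le> (\<integral>\<^sup>+ N. branch_sum (\<lambda>N. ennreal (norm (g N))) N \<partial>\<Omega>)"
    unfolding branch_sum_def by (intro nn_integral_mono) (simp add: sum_ennreal sum_abs)
  also have "\<dots> = ennreal m * (\<integral>\<^sup>+ N. ennreal (norm (g N)) \<partial>\<Omega>)"
    by (rule nn_integral_branch_sum) measurable
  also have "\<dots> < \<infinity>"
    using g by (auto simp: integrable_iff_bounded ennreal_mult_less_top)
  finally show "(\<integral>\<^sup>+ N. ennreal (norm (branch_sum g N)) \<partial>\<Omega>) < \<infinity>" .
qed

lemma expectation_branch_sum_nonneg:
  fixes g :: "_ \<Rightarrow> real"
  assumes g: "integrable \<Omega> g" and nn: "\<And>N. 0 \<le> g N"
  shows "expectation (branch_sum g) = m * expectation g"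
proof -
  have [measurable]: "g \<in> borel_measurable \<Omega>" using g by auto
  have "ennreal (expectation (branch_sum g)) = (\<integral>\<^sup>+ N. ennreal (branch_sum g N) \<partial>\<Omega>)"
    using integrable_branch_sum[OF g] nn
    by (intro nn_integral_eq_integral[symmetric]) (auto simp: branch_sum_def sum_nonneg)
  also have "\<dots> = (\<integral>\<^sup>+ N. branch_sum (\<lambda>N. ennreal (g N)) N \<partial>\<Omega>)"
    using nn by (simp add: branch_sum_def sum_ennreal)
  also have "\<dots> = ennreal m * ennreal (expectation g)"
    using nn nn_integral_eq_integral[OF g] by (subst nn_integral_branch_sum) auto
  also have "\<dots> = ennreal (m * expectation g)"
    using mean_gt_1 by (simp add: ennreal_mult')
  finally have eq: "ennreal (expectation (branch_sum g)) = ennreal (m * expectation g)" .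
  have "0 \<le> expectation (branch_sum g)" "0 \<le> expectation g"
    using nn by (auto simp: branch_sum_def intro!: Bochner_Integration.integral_nonneg sum_nonneg)
  with eq show ?thesis
    using mean_gt_1 by (simp add: ennreal_inj)
qed

lemma branch_sum_diff:
  fixes g h :: "_ \<Rightarrow> real"
  shows "branch_sum (\<lambda>N. g N - h N) N = branch_sum g N - branch_sum h N"
  by (simp add: branch_sum_def sum_subtractf)

text \<open>Reduction to the non-negative case, which comes from the \<open>ennreal\<close>
  identity, by splitting \<open>g\<close> into positive and negative parts.\<close>

lemma expectation_branch_sum:
  fixes g :: "_ \<Rightarrow> real"
  assumes g: "integrable \<Omega> g"
  shows "expectation (branch_sum g) = m * expectation g"
proof -
  have g': "g = (\<lambda>N. max 0 (g N) - max 0 (- g N))" by (auto simp: max_def)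
  have int: "integrable \<Omega> (\<lambda>N. max 0 (g N))" "integrable \<Omega> (\<lambda>N. max 0 (- g N))"
    using g by auto
  note int' = integrable_branch_sum[OF int(1)] integrable_branch_sum[OF int(2)]
  have "expectation (branch_sum g)
      = expectation (\<lambda>N. branch_sum (\<lambda>N. max 0 (g N)) N - branch_sum (\<lambda>N. max 0 (- g N)) N)"
    by (subst g', subst branch_sum_diff[abs_def]) simp
  also have "\<dots> = m * expectation (\<lambda>N. max 0 (g N)) - m * expectation (\<lambda>N. max 0 (- g N))"
    using int' by (simp add: expectation_branch_sum_nonneg[OF int(1)] expectation_branch_sum_nonneg[OF int(2)])
  also have "\<dots> = m * expectation g"
    by (subst (3) g') (use int in \<open>simp add: algebra_simps\<close>)
  finally show ?thesis .
qed

text \<open>Given \<open>k\<close> children, the summands are independent and centred, so only the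
  \<open>k\<close> diagonal terms survive; averaging over \<open>k\<close> gives the factor
  \<open>m\<close>.\<close>

lemma second_moment_branch_sum:
  fixes g :: "_ \<Rightarrow> real"
  assumes g: "integrable \<Omega> g" "expectation g = 0" "integrable \<Omega> (\<lambda>N. (g N)\<^sup>2)"
  shows "(\<integral>\<^sup>+ N. ennreal ((branch_sum g N)\<^sup>2) \<partial>\<Omega>) = ennreal m * (\<integral>\<^sup>+ N. ennreal ((g N)\<^sup>2) \<partial>\<Omega>)"
proof -
  have [measurable]: "g \<in> borel_measurable \<Omega>" using g by auto
  have *: "(\<integral>\<^sup>+ F. ennreal ((\<Sum>i<k. g (F i))\<^sup>2) \<partial>forest_measure q)
      = ennreal (real k) * ennreal (expectation (\<lambda>N. (g N)\<^sup>2))" for k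
  proof -
    have int: "integrable (forest_measure q) (\<lambda>F. g (F i) * g (F j))" for i j
      using integral_forest_mult(1)[OF _ g(1) g(1), of i j] integrable_forest_component[OF g(3), of i]
      by (cases "i = j") (simp_all add: power2_eq_square)
    have ex: "(\<integral> F. g (F i) * g (F j) \<partial>forest_measure q)
        = (if i = j then expectation (\<lambda>N. (g N)\<^sup>2) else 0)" for i j
      using integral_forest_mult(2)[OF _ g(1) g(1), of i j] g(2)
        integral_forest_component[of "\<lambda>N. (g N)\<^sup>2" q i]
      by (cases "i = j") (simp_all add: power2_eq_square)
    have sq: "(\<Sum>i<k. g (F i))\<^sup>2 = (\<Sum>i<k. \<Sum>j<k. g (F i) * g (F j))" for F
      by (simp add: power2_eq_square sum_product)
    have int1: "integrable (forest_measure q) (\<lambda>F. \<Sum>j<k. g (F i) * g (F j))" for i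
      by (rule Bochner_Integration.integrable_sum) (rule int)
    have int2: "integrable (forest_measure q) (\<lambda>F. (\<Sum>i<k. g (F i))\<^sup>2)"
      unfolding sq by (rule Bochner_Integration.integrable_sum) (rule int1)
    have "(\<integral>\<^sup>+ F. ennreal ((\<Sum>i<k. g (F i))\<^sup>2) \<partial>forest_measure q)
        = ennreal (\<integral> F. (\<Sum>i<k. g (F i))\<^sup>2 \<partial>forest_measure q)"
      by (rule nn_integral_eq_integral[OF int2]) simp
    also have "(\<integral> F. (\<Sum>i<k. g (F i))\<^sup>2 \<partial>forest_measure q)
        = (\<Sum>i<k. \<integral> F. (\<Sum>j<k. g (F i) * g (F j)) \<partial>forest_measure q)"
      unfolding sq by (rule Bochner_Integration.integral_sum) (rule int1)
    also have "\<dots> = (\<Sum>i<k. \<Sum>j<k. \<integral> F. g (F i) * g (F j) \<partial>forest_measure q)"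
      by (intro sum.cong refl, rule Bochner_Integration.integral_sum) (rule int)
    also have "\<dots> = real k * expectation (\<lambda>N. (g N)\<^sup>2)"
      by (simp add: ex)
    finally show ?thesis by (simp add: ennreal_mult')
  qed
  have "(\<integral>\<^sup>+ N. ennreal ((branch_sum g N)\<^sup>2) \<partial>\<Omega>)
      = (\<integral>\<^sup>+ k. ennreal (real k) * ennreal (expectation (\<lambda>N. (g N)\<^sup>2)) \<partial>measure_pmf q)"
    by (subst nn_integral_counts_measure) (simp_all add: branch_sum_graft *)
  also have "\<dots> = ennreal m * ennreal (expectation (\<lambda>N. (g N)\<^sup>2))"
    by (subst nn_integral_multc) (simp_all add: nn_integral_offspring)
  also have "ennreal (expectation (\<lambda>N. (g N)\<^sup>2)) = (\<integral>\<^sup>+ N. ennreal ((g N)\<^sup>2) \<partial>\<Omega>)"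
    by (rule nn_integral_eq_integral[symmetric]) (use g in auto)
  finally show ?thesis .
qed

text \<open>The three claims are proved together because \<open>second_moment_branch_sum\<close>
  consumes all of them at the previous level. Second moments grow like \<open>m ^ n\<close> only,
  which is small against the square of the normalisation \<open>m ^ n\<close>.\<close>

lemma branch_sum_iter_centred:
  fixes g :: "_ \<Rightarrow> real"
  assumes g: "integrable \<Omega> g" "expectation g = 0" "integrable \<Omega> (\<lambda>N. (g N)\<^sup>2)"
  shows "integrable \<Omega> ((branch_sum ^^ n) g) \<and> expectation ((branch_sum ^^ n) g) = 0 \<and>
    (\<integral>\<^sup>+ N. ennreal (((branch_sum ^^ n) g N)\<^sup>2) \<partial>\<Omega>) = ennreal m ^ n * (\<integral>\<^sup>+ N. ennreal ((g N)\<^sup>2) \<partial>\<Omega>)"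
proof (induction n)
  case (Suc n)
  let ?h = "(branch_sum ^^ n) g"
  have [measurable]: "g \<in> borel_measurable \<Omega>" using g by auto
  have fin: "(\<integral>\<^sup>+ N. ennreal ((g N)\<^sup>2) \<partial>\<Omega>) < \<infinity>"
    using g(3) by (simp add: integrable_iff_bounded)
  have "(\<integral>\<^sup>+ N. ennreal ((?h N)\<^sup>2) \<partial>\<Omega>) < \<infinity>"
    using Suc fin by (simp add: ennreal_mult_less_top power_less_top_ennreal)
  then have "integrable \<Omega> (\<lambda>N. (?h N)\<^sup>2)"
    by (intro integrableI_bounded) auto
  from second_moment_branch_sum[OF _ _ this] Suc show ?case
    by (simp add: integrable_branch_sum expectation_branch_sum mult.assoc)
qed (use g in simp)

end


section \<open>Convergence of the normalised generation sizes\<close>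

lemma branch_sum_iter_diff:
  fixes g h :: "_ \<Rightarrow> real"
  shows "(branch_sum ^^ n) (\<lambda>N. g N - h N) N = (branch_sum ^^ n) g N - (branch_sum ^^ n) h N"
proof (induction n arbitrary: N)
  case (Suc n)
  then show ?case by (simp add: branch_sum_def sum_subtractf)
qed simp

lemma branch_sum_iter_add:
  fixes g h :: "_ \<Rightarrow> real"
  shows "(branch_sum ^^ n) (\<lambda>N. g N + h N) N = (branch_sum ^^ n) g N + (branch_sum ^^ n) h N"
proof (induction n arbitrary: N)
  case (Suc n)
  then show ?case by (simp add: branch_sum_def sum.distrib)
qed simp

lemma branch_sum_iter_mult:
  fixes g :: "_ \<Rightarrow> real"
  shows "(branch_sum ^^ n) (\<lambda>N. c * g N) N = c * (branch_sum ^^ n) g N"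
proof (induction n arbitrary: N)
  case (Suc n)
  then show ?case by (simp add: branch_sum_def sum_distrib_left)
qed simp

lemma branch_sum_iter_nonneg:
  fixes g :: "_ \<Rightarrow> real"
  assumes "\<And>N. 0 \<le> g N"
  shows "0 \<le> (branch_sum ^^ n) g N"
proof (induction n arbitrary: N)
  case (Suc n)
  then show ?case by (simp add: branch_sum_def sum_nonneg)
qed (simp add: assms)

text \<open>Each increment is at most \<open>sqrt \<rho>\<close> times the k-th power of
  \<open>1 / sqrt b\<close>, so the increments are dominated by a geometric series; its sum is the
  stated bound.\<close>

lemma convergent_of_weighted_increments:
  fixes w :: "nat \<Rightarrow> real"
  assumes b: "1 < b" and incr: "\<And>k. b ^ k * (w (Suc k) - w k)\<^sup>2 \<le> \<rho>"
  shows "convergent w" and "\<bar>w n - w 0\<bar> \<le> sqrt \<rho> / (1 - 1 / sqrt b)"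
proof -
  define c where "c = 1 / sqrt b"
  have c: "0 < c" "c < 1" using b by (auto simp: c_def)
  have \<rho>: "0 \<le> \<rho>" using incr[of 0] by (smt (verit) mult_nonneg_nonneg zero_le_power2 power_0)
  have bound: "\<bar>w (Suc k) - w k\<bar> \<le> sqrt \<rho> * c ^ k" for k
  proof -
    have "(c ^ k)\<^sup>2 * b ^ k = 1"
      using b by (simp add: c_def power_divide flip: power_mult power_mult_distrib)
        (simp add: mult.commute[of k 2] power_mult)
    then have "(w (Suc k) - w k)\<^sup>2 = (c ^ k)\<^sup>2 * (b ^ k * (w (Suc k) - w k)\<^sup>2)"
      by (simp add: mult.assoc[symmetric])
    also have "\<dots> \<le> (c ^ k)\<^sup>2 * \<rho>" by (intro mult_left_mono incr) simp
    finally have "sqrt ((w (Suc k) - w k)\<^sup>2) \<le> sqrt ((c ^ k)\<^sup>2 * \<rho>)" by (rule real_sqrt_le_mono)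
    then show ?thesis using c by (simp add: real_sqrt_mult mult.commute)
  qed
  have geo: "summable (\<lambda>k. sqrt \<rho> * c ^ k)"
    using c by (intro summable_mult summable_geometric) auto
  have sum: "summable (\<lambda>k. \<bar>w (Suc k) - w k\<bar>)"
    by (rule summable_comparison_test'[OF geo]) (use bound in auto)
  have tele: "(\<Sum>k<n. w (Suc k) - w k) = w n - w 0" for n
    by (simp add: sum_lessThan_telescope)
  have "convergent (\<lambda>n. (\<Sum>k<n. w (Suc k) - w k) + w 0)"
    using summable_rabs_cancel[OF sum] by (intro convergent_add convergent_const)
      (simp add: summable_iff_convergent)
  then show "convergent w" by (simp add: tele)
  have "\<bar>w n - w 0\<bar> \<le> (\<Sum>k<n. \<bar>w (Suc k) - w k\<bar>)"
    by (subst tele[symmetric]) (rule sum_abs)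
  also have "\<dots> \<le> (\<Sum>k<n. sqrt \<rho> * c ^ k)" by (intro sum_mono bound)
  also have "\<dots> \<le> (\<Sum>k. sqrt \<rho> * c ^ k)"
    using geo \<rho> c by (intro sum_le_suminf) auto
  also have "\<dots> = sqrt \<rho> / (1 - c)"
    using c by (simp add: suminf_mult suminf_geometric)
  finally show "\<bar>w n - w 0\<bar> \<le> sqrt \<rho> / (1 - 1 / sqrt b)" by (simp add: c_def)
qed

section \<open>The martingale of normalised generation sizes\<close>

context offspring begin

text \<open>Summing the constant 1 over level \<open>n\<close> counts the n-th generation, so this
  is the Galton-Watson martingale.\<close>

definition W_seq :: "nat \<Rightarrow> (nat list \<Rightarrow> nat) \<Rightarrow> real" where
  "W_seq n N = (branch_sum ^^ n) (\<lambda>_. 1) N / m ^ n"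

text \<open>Where the martingale diverges the value of \<open>lim\<close> is arbitrary, hence the
  convergence hypotheses in the facts about \<open>W\<close>.\<close>

definition W :: "(nat list \<Rightarrow> nat) \<Rightarrow> real" where
  "W N = lim (\<lambda>n. W_seq n N)"

text \<open>The first increment \<open>W_seq 1 N - W_seq 0 N\<close>; all later increments are built
  from copies of it in \<open>W_seq_increment\<close>.\<close>

definition W_step :: "(nat list \<Rightarrow> nat) \<Rightarrow> real" where
  "W_step N = real (N []) / m - 1"

text \<open>
  The weights \<open>sqrt m ^ k\<close> grow slowly enough for \<open>W_dev\<close> to be integrable, and fast enough for its
  finiteness to force geometric convergence of \<open>W_seq\<close>; so \<open>W_dev\<close> also dominates all the squares
  \<open>(W_seq n)\<^sup>2\<close> up to constants.
\<close>

definition W_dev :: "(nat list \<Rightarrow> nat) \<Rightarrow> ennreal" where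
  "W_dev N = (\<Sum>k. ennreal (sqrt m ^ k * (W_seq (Suc k) N - W_seq k N)\<^sup>2))"

lemma m_pos: "0 < m"
  using mean_gt_1 by auto

lemma W_seq_0 [simp]: "W_seq 0 N = 1"
  by (simp add: W_seq_def)

lemma W_seq_Suc: "W_seq (Suc n) N = branch_sum (W_seq n) N / m"
  by (simp add: W_seq_def branch_sum_def sum_divide_distrib mult.commute)

lemma W_seq_nonneg: "0 \<le> W_seq n N"
  using m_pos by (simp add: W_seq_def branch_sum_iter_nonneg)

lemma measurable_W_seq [measurable]: "W_seq n \<in> borel_measurable \<Omega>"
  unfolding W_seq_def by measurable

lemma measurable_W [measurable]: "W \<in> borel_measurable \<Omega>"
  unfolding W_def by measurable

lemma measurable_W_dev [measurable]: "W_dev \<in> borel_measurable \<Omega>"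
  unfolding W_dev_def by measurable

text \<open>Splits at the last generation instead of the first: every vertex of level
  \<open>n\<close> contributes the \<open>W_step\<close> of its own subtree. Iterates of
  \<open>branch_sum\<close> commute, so summing its value at the constant 1 over level
  \<open>n\<close> counts level \<open>n + 1\<close>.\<close>

lemma W_seq_increment: "W_seq (Suc n) N - W_seq n N = (branch_sum ^^ n) W_step N / m ^ n"
proof -
  have "W_step = (\<lambda>N. (1 / m) * branch_sum (\<lambda>_. 1) N - 1)"
    by (auto simp: W_step_def branch_sum_def)
  then have "(branch_sum ^^ n) W_step N
      = (1 / m) * (branch_sum ^^ n) (branch_sum (\<lambda>_. 1)) N - (branch_sum ^^ n) (\<lambda>_. 1) N"
    by (simp only: branch_sum_iter_diff branch_sum_iter_mult)
  also have "(branch_sum ^^ n) (branch_sum (\<lambda>_. 1 :: real)) = (branch_sum ^^ Suc n) (\<lambda>_. 1)"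
    by (simp add: funpow_swap1)
  finally have "(branch_sum ^^ n) W_step N / m ^ n
      = (branch_sum ^^ Suc n) (\<lambda>_. 1) N / (m * m ^ n) - (branch_sum ^^ n) (\<lambda>_. 1) N / m ^ n"
    by (simp add: diff_divide_distrib)
  then show ?thesis by (simp add: W_seq_def)
qed

lemma distr_root: "distr \<Omega> (measure_pmf q) (\<lambda>N. N []) = measure_pmf q"
  by (rule distr_PiM_component) (auto intro: prob_space_measure_pmf)

lemma measurable_root: "(\<lambda>N. N []) \<in> \<Omega> \<rightarrow>\<^sub>M measure_pmf q"
  by (rule measurable_component_singleton) auto

lemma W_step: "integrable \<Omega> W_step" "expectation W_step = 0" "integrable \<Omega> (\<lambda>N. (W_step N)\<^sup>2)"
proof -
  have W_step: "W_step = (\<lambda>N. branch_sum (\<lambda>_. 1) N / m - 1)"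
    by (auto simp: W_step_def branch_sum_def)
  have int: "integrable \<Omega> (branch_sum (\<lambda>_. 1 :: real))"
    by (rule integrable_branch_sum) simp
  then show "integrable \<Omega> W_step" unfolding W_step by simp
  show "expectation W_step = 0"
    unfolding W_step using int m_pos by (simp add: expectation_branch_sum prob_space)
  have "integrable (measure_pmf q) (\<lambda>k. ((real k - m)\<^sup>2) / m\<^sup>2)"
    using variance_finite by simp
  then have "integrable (distr \<Omega> (measure_pmf q) (\<lambda>N. N [])) (\<lambda>k. ((real k - m)\<^sup>2) / m\<^sup>2)"
    by (simp add: distr_root)
  from integrable_distr[OF measurable_root this]
  have "integrable \<Omega> (\<lambda>N. (real (N []) - m)\<^sup>2 / m\<^sup>2)" .
  also have "(\<lambda>N. (real (N []) - m)\<^sup>2 / m\<^sup>2) = (\<lambda>N. (W_step N)\<^sup>2)"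
    using m_pos by (auto simp: W_step_def field_simps power2_eq_square)
  finally show "integrable \<Omega> (\<lambda>N. (W_step N)\<^sup>2)" .
qed

text \<open>With \<open>v\<close> the variance of \<open>W_step\<close>, the k-th squared increment
  has mean \<open>v / m ^ k\<close>; the weight leaves \<open>v / sqrt m ^ k\<close>, a convergent
  geometric series.\<close>

lemma nn_integral_W_dev: "(\<integral>\<^sup>+ N. W_dev N \<partial>\<Omega>) < \<infinity>"
proof -
  define v where "v = expectation (\<lambda>N. (W_step N)\<^sup>2)"
  have v: "(\<integral>\<^sup>+ N. ennreal ((W_step N)\<^sup>2) \<partial>\<Omega>) = ennreal v"
    unfolding v_def by (rule nn_integral_eq_integral) (use W_step in auto)
  have v0: "0 \<le> v" by (simp add: v_def)
  have "(\<integral>\<^sup>+ N. ennreal (sqrt m ^ k * (W_seq (Suc k) N - W_seq k N)\<^sup>2) \<partial>\<Omega>)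
      = ennreal (v * (1 / sqrt m) ^ k)" for k
  proof -
    have "(\<integral>\<^sup>+ N. ennreal (sqrt m ^ k * (W_seq (Suc k) N - W_seq k N)\<^sup>2) \<partial>\<Omega>)
        = (\<integral>\<^sup>+ N. ennreal (sqrt m ^ k / (m ^ k)\<^sup>2) * ennreal (((branch_sum ^^ k) W_step N)\<^sup>2) \<partial>\<Omega>)"
      using m_pos by (simp add: W_seq_increment power_divide ennreal_mult'[symmetric])
    also have "\<dots> = ennreal (sqrt m ^ k / (m ^ k)\<^sup>2) * (ennreal m ^ k * ennreal v)"
      using branch_sum_iter_centred[OF W_step, of k]
      by (subst nn_integral_cmult) (auto simp: v)
    also have "\<dots> = ennreal (sqrt m ^ k / (m ^ k)\<^sup>2 * (m ^ k * v))"
      using m_pos v0 by (simp add: ennreal_power flip: ennreal_mult')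
    also have "sqrt m ^ k / (m ^ k)\<^sup>2 * (m ^ k * v) = v * (sqrt m / m) ^ k"
      using m_pos by (simp add: power2_eq_square field_simps)
    also have "sqrt m / m = 1 / sqrt m"
      using m_pos by (simp add: field_simps)
    finally show ?thesis .
  qed
  moreover have "summable (\<lambda>k. v * (1 / sqrt m) ^ k)"
    using mean_gt_1 by (intro summable_mult summable_geometric) auto
  ultimately show ?thesis
    unfolding W_dev_def
    by (subst nn_integral_suminf) (use v0 m_pos in \<open>auto simp: suminf_ennreal2\<close>)
qed

lemma AE_W_dev_finite: "AE N in \<Omega>. W_dev N < \<infinity>"
  using nn_integral_PInf_AE[OF measurable_W_dev] nn_integral_W_dev
  by (auto simp: less_top)

text \<open>Each term of the series \<open>W_dev N\<close> is at most its sum, so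
  \<open>convergent_of_weighted_increments\<close> applies with \<open>b = sqrt m\<close>; this is
  where the double root comes from.\<close>

lemma W_seq_bounds:
  assumes "W_dev N < \<infinity>"
  shows "convergent (\<lambda>n. W_seq n N)"
    and "\<bar>W_seq n N - 1\<bar> \<le> sqrt (enn2real (W_dev N)) / (1 - 1 / sqrt (sqrt m))"
proof -
  have "sqrt m ^ k * (W_seq (Suc k) N - W_seq k N)\<^sup>2 \<le> enn2real (W_dev N)" for k
  proof -
    have "ennreal (sqrt m ^ k * (W_seq (Suc k) N - W_seq k N)\<^sup>2) \<le> W_dev N"
      unfolding W_dev_def using sum_le_suminf[OF summableI, of "{k}"] by simp
    then show ?thesis
      using assms by (metis enn2real_mono enn2real_ennreal infinity_ennreal_def m_pos
          mult_nonneg_nonneg real_sqrt_ge_zero less_imp_le zero_le_power zero_le_power2)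
  qed
  note * = convergent_of_weighted_increments[of "sqrt m" "\<lambda>n. W_seq n N", OF _ this]
  show "convergent (\<lambda>n. W_seq n N)"
    by (rule *) (use mean_gt_1 in simp)
  show "\<bar>W_seq n N - 1\<bar> \<le> sqrt (enn2real (W_dev N)) / (1 - 1 / sqrt (sqrt m))"
    using *(2)[of n] mean_gt_1 by simp
qed

lemma AE_convergent_W_seq: "AE N in \<Omega>. convergent (\<lambda>n. W_seq n N)"
  using AE_W_dev_finite by eventually_elim (rule W_seq_bounds)

lemma tendsto_W: "convergent (\<lambda>n. W_seq n N) \<Longrightarrow> (\<lambda>n. W_seq n N) \<longlonglongrightarrow> W N"
  by (simp add: W_def convergent_LIMSEQ_iff)

lemma W_nonneg: "convergent (\<lambda>n. W_seq n N) \<Longrightarrow> 0 \<le> W N"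
  by (rule LIMSEQ_le_const[OF tendsto_W]) (auto intro: W_seq_nonneg)

text \<open>The limit of \<open>W_seq_Suc\<close>, which may be taken termwise because the sum over
  the children is finite.\<close>

lemma W_rec:
  assumes "convergent (\<lambda>n. W_seq n N)"
    and "\<And>i. i < N [] \<Longrightarrow> convergent (\<lambda>n. W_seq n (subcounts i N))"
  shows "W N = branch_sum W N / m"
proof (rule LIMSEQ_unique)
  show "(\<lambda>n. W_seq (Suc n) N) \<longlonglongrightarrow> W N"
    using tendsto_W[OF assms(1)] by (rule LIMSEQ_Suc)
  show "(\<lambda>n. W_seq (Suc n) N) \<longlonglongrightarrow> branch_sum W N / m"
    unfolding W_seq_Suc branch_sum_def
    by (intro tendsto_divide tendsto_sum tendsto_W assms(2)) (use m_pos in auto)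
qed

section \<open>Moments of the limit\<close>

lemma integrable_W_dev: "integrable \<Omega> (\<lambda>N. enn2real (W_dev N))"
proof (rule integrableI_bounded)
  have "(\<integral>\<^sup>+ N. ennreal (norm (enn2real (W_dev N))) \<partial>\<Omega>) = (\<integral>\<^sup>+ N. W_dev N \<partial>\<Omega>)"
    using AE_W_dev_finite by (intro nn_integral_cong_AE, eventually_elim) auto
  then show "(\<integral>\<^sup>+ N. ennreal (norm (enn2real (W_dev N))) \<partial>\<Omega>) < \<infinity>"
    using nn_integral_W_dev by simp
qed measurable

text \<open>The bound on the deviation of \<open>W_seq\<close> from 1 is uniform in \<open>n\<close>
  and so passes to \<open>W\<close>; its square is a multiple of the integrable
  \<open>W_dev\<close>.\<close>

lemma integrable_W_square: "integrable \<Omega> (\<lambda>N. (W N)\<^sup>2)"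
proof -
  define C where "C = 1 / (1 - 1 / sqrt (sqrt m))"
  show ?thesis
  proof (rule Bochner_Integration.integrable_bound)
    show "integrable \<Omega> (\<lambda>N. 2 + 2 * C\<^sup>2 * enn2real (W_dev N))"
      using integrable_W_dev by simp
    show "AE N in \<Omega>. norm ((W N)\<^sup>2) \<le> norm (2 + 2 * C\<^sup>2 * enn2real (W_dev N))"
      using AE_W_dev_finite
    proof eventually_elim
      case (elim N)
      let ?r = "sqrt (enn2real (W_dev N))"
      have "\<bar>W_seq n N - 1\<bar> \<le> C * ?r" for n
        using W_seq_bounds(2)[OF elim] by (simp add: C_def)
      moreover have "(\<lambda>n. \<bar>W_seq n N - 1\<bar>) \<longlonglongrightarrow> \<bar>W N - 1\<bar>"
        by (intro tendsto_intros tendsto_W W_seq_bounds(1) elim)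
      ultimately have "\<bar>W N - 1\<bar> \<le> C * ?r"
        by (intro LIMSEQ_le_const2) auto
      then have "(W N - 1)\<^sup>2 \<le> (C * ?r)\<^sup>2"
        by (metis abs_ge_zero power2_abs power_mono)
      also have "\<dots> = C\<^sup>2 * enn2real (W_dev N)" by (simp add: power_mult_distrib)
      finally have 1: "(W N - 1)\<^sup>2 \<le> C\<^sup>2 * enn2real (W_dev N)" .
      \<comment> \<open>Dropping the second square bounds the square of \<open>W N\<close> by 2 plus
        twice the square of \<open>W N - 1\<close>.\<close>
      have "(W N)\<^sup>2 + (W N - 2)\<^sup>2 = 2 + 2 * (W N - 1)\<^sup>2"
        by (simp add: power2_eq_square algebra_simps)
      with 1 have "(W N)\<^sup>2 \<le> 2 + 2 * (C\<^sup>2 * enn2real (W_dev N))"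
        by (smt (verit) zero_le_power2)
      then show ?case by simp
    qed
  qed measurable
qed

text \<open>Every \<open>W_seq n\<close> has mean 1. Dominated convergence applies with a majorant
  built from \<open>W_dev\<close>, using that a square root is at most 1 plus its argument.\<close>

lemma expectation_W: "expectation W = 1"
proof (rule LIMSEQ_unique)
  define C where "C = 1 / (1 - 1 / sqrt (sqrt m))"
  have C: "0 \<le> C" using mean_gt_1 by (simp add: C_def)
  show "(\<lambda>n. expectation (W_seq n)) \<longlonglongrightarrow> expectation W"
  proof (rule integral_dominated_convergence)
    show "integrable \<Omega> (\<lambda>N. 1 + C * (1 + enn2real (W_dev N)))"
      using integrable_W_dev by simp
    show "AE N in \<Omega>. (\<lambda>n. W_seq n N) \<longlonglongrightarrow> W N"
      using AE_convergent_W_seq by eventually_elim (rule tendsto_W)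
    show "AE N in \<Omega>. norm (W_seq n N) \<le> 1 + C * (1 + enn2real (W_dev N))" for n
      using AE_W_dev_finite
    proof eventually_elim
      case (elim N)
      let ?r = "sqrt (enn2real (W_dev N))"
      have "?r * 2 \<le> 1 + ?r\<^sup>2"
        using zero_le_power2[of "?r - 1"] unfolding power2_diff by simp
      then have "?r \<le> 1 + enn2real (W_dev N)"
        using enn2real_nonneg[of "W_dev N"] real_sqrt_pow2[OF enn2real_nonneg, of "W_dev N"] by linarith
      then have "C * ?r \<le> C * (1 + enn2real (W_dev N))" using C by (rule mult_left_mono)
      then show ?case using W_seq_bounds(2)[OF elim, of n] by (simp add: C_def)
    qed
  qed auto
  have "integrable \<Omega> (W_seq n) \<and> expectation (W_seq n) = 1" for n
  proof (induction n)
    case 0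
    have "W_seq 0 = (\<lambda>_. 1)" by auto
    then show ?case using prob_space by simp
  next
    case (Suc n)
    have "W_seq (Suc n) = (\<lambda>N. branch_sum (W_seq n) N / m)" by (auto simp: W_seq_Suc)
    then show ?case
      using Suc m_pos by (simp add: integrable_branch_sum expectation_branch_sum)
  qed
  then show "(\<lambda>n. expectation (W_seq n)) \<longlonglongrightarrow> 1" by simp
qed

section \<open>Positivity of the limit\<close>

lemma AE_subcounts:
  assumes "AE N in \<Omega>. P N"
  shows "AE N in \<Omega>. \<forall>i. P (subcounts i N)"
proof -
  have "AE N in \<Omega>. P (subcounts i N)" for i
    using assms by (intro AE_distrD[OF measurable_subcounts, of _ q]) (subst distr_subcounts)
  then show ?thesis by (simp add: AE_all_countable)
qed

lemma AE_root_pos: "AE N in \<Omega>. 1 \<le> N []"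
proof (rule AE_distrD[OF measurable_root])
  show "AE k in distr \<Omega> (measure_pmf q) (\<lambda>N. N []). 1 \<le> k"
    unfolding distr_root using offspring_pos by (simp add: AE_measure_pmf_iff)
qed

text \<open>Let \<open>r\<close> be the probability that \<open>W\<close> vanishes. By
  \<open>W_rec\<close> it then vanishes at all children; looking at no more than two of them gives r
  \<le> p r + (1 - p) r^2 with p = \<open>pmf q 1\<close> < 1, hence r = 0 or r = 1. The second
  value contradicts \<open>expectation_W\<close>.\<close>

lemma AE_W_pos: "AE N in \<Omega>. 0 < W N"
proof -
  define A where "A = {N. W N = 0}"
  have A [measurable]: "A \<in> sets \<Omega>"
  proof -
    have "{N \<in> space \<Omega>. W N = 0} \<in> sets \<Omega>" by measurable
    then show ?thesis by (simp add: A_def)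
  qed
  have ind: "integrable (measure_pmf q) (indicator {1} :: nat \<Rightarrow> real)"
    by (rule integrable_real_indicator) (simp_all add: measure_pmf.emeasure_eq_measure)
  define r where "r = prob A"
  define p where "p = pmf q 1"
  \<comment> \<open>An only child is tested alone, otherwise the first two children are; a childless
    root is excluded by \<open>AE_root_pos\<close>.\<close>
  let ?f = "\<lambda>k F. if k = (1::nat) then indicator A (F (0::nat)) else indicator A (F 0) * indicator A (F 1)"
  have "AE N in \<Omega>. indicator A N \<le> (?f (N []) (\<lambda>i. subcounts i N) :: real)"
    using AE_convergent_W_seq AE_subcounts[OF AE_convergent_W_seq] AE_root_pos
  proof eventually_elim
    case (elim N)
    show ?case
    proof (cases "N \<in> A")
      case True
      have "branch_sum W N = 0"
        using W_rec[of N] elim True m_pos by (simp add: A_def)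
      then have "\<forall>i<N []. W (subcounts i N) = 0"
        using elim(2) W_nonneg by (subst (asm) branch_sum_def) (simp add: sum_nonneg_eq_0_iff)
      moreover have "N [] \<noteq> 1 \<Longrightarrow> 1 < N []" "0 < N []" using elim(3) by auto
      ultimately show ?thesis using True by (auto simp: A_def)
    qed auto
  qed
  then have "(\<integral>\<^sup>+ N. ennreal (indicator A N) \<partial>\<Omega>) \<le> (\<integral>\<^sup>+ N. ennreal (?f (N []) (\<lambda>i. subcounts i N)) \<partial>\<Omega>)"
    by (intro nn_integral_mono_AE, eventually_elim) (rule ennreal_leI)
  also have "\<dots> = (\<integral>\<^sup>+ k. \<integral>\<^sup>+ F. ennreal (?f k F) \<partial>forest_measure q \<partial>measure_pmf q)"
    by (subst nn_integral_counts_measure) (measurable, simp only: subcounts_graft graft_Nil)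
  \<comment> \<open>A single expression for \<open>r\<close> at k = 1 and the square of
    \<open>r\<close> at all other \<open>k\<close>, so that its integral is linear in
    \<open>p\<close>.\<close>
  also have "\<dots> = (\<integral>\<^sup>+ k. ennreal (r\<^sup>2 + (r - r\<^sup>2) * indicator {1} k) \<partial>measure_pmf q)"
  proof (rule nn_integral_cong)
    fix k
    have i: "integrable \<Omega> (indicator A :: _ \<Rightarrow> real)"
      by (rule integrable_real_indicator[OF A]) (simp add: emeasure_eq_measure)
    have "(\<integral>\<^sup>+ F. ennreal (?f k F) \<partial>forest_measure q) = ennreal (if k = 1 then r else r * r)"
      using nn_integral_eq_integral[OF integrable_forest_component[OF i, of 0]]
        nn_integral_eq_integral[OF integral_forest_mult(1)[OF _ i i, of 0 1]]
        integral_forest_mult(2)[OF _ i i, of 0 1]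
        integral_forest_component[of "indicator A :: _ \<Rightarrow> real" q 0]
      by (simp add: r_def)
    then show "(\<integral>\<^sup>+ F. ennreal (?f k F) \<partial>forest_measure q) = ennreal (r\<^sup>2 + (r - r\<^sup>2) * indicator {1} k)"
      by (simp add: power2_eq_square split: if_splits)
  qed
  also have "\<dots> = ennreal (\<integral> k. r\<^sup>2 + (r - r\<^sup>2) * indicator {1} k \<partial>measure_pmf q)"
  proof (rule nn_integral_eq_integral)
    have "r\<^sup>2 \<le> r" unfolding power2_eq_square r_def by (rule mult_left_le) auto
    then show "AE k in measure_pmf q. 0 \<le> r\<^sup>2 + (r - r\<^sup>2) * indicator {1} k" by auto
  qed (use ind in simp)
  also have "(\<integral> k. r\<^sup>2 + (r - r\<^sup>2) * indicator {1} k \<partial>measure_pmf q) = r\<^sup>2 + (r - r\<^sup>2) * p"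
    using ind by (simp add: p_def pmf.rep_eq)
  finally have "ennreal r \<le> ennreal (r\<^sup>2 + (r - r\<^sup>2) * p)"
    by (simp add: r_def ennreal_indicator emeasure_eq_measure)
  moreover have r01: "0 \<le> r" "r \<le> 1" by (auto simp: r_def)
  moreover have "0 \<le> (r - r\<^sup>2) * p"
    using r01 by (intro mult_nonneg_nonneg) (auto simp: p_def power2_eq_square mult_left_le)
  ultimately have "r \<le> r\<^sup>2 + (r - r\<^sup>2) * p" by (subst (asm) ennreal_le_iff) auto
  then have "(r * (1 - r)) * (1 - p) \<le> 0" by (simp add: power2_eq_square algebra_simps)
  moreover have "p < 1" using q1 pmf_le_1[of q 1] by (simp add: p_def order_less_le)
  ultimately have "r * (1 - r) \<le> 0" by (simp add: mult_le_0_iff)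
  then have "r = 0 \<or> r = 1" using r01 by (auto simp: mult_le_0_iff)
  moreover have "r \<noteq> 1"
  proof
    assume "r = 1"
    then have "AE N in \<Omega>. N \<in> A" unfolding r_def by (simp add: prob_eq_1)
    then have "AE N in \<Omega>. W N = 0" by eventually_elim (simp add: A_def)
    then have "expectation W = 0" by (subst integral_cong_AE[of _ _ "\<lambda>_. 0"]) auto
    then show False using expectation_W by simp
  qed
  ultimately have "AE N in \<Omega>. N \<notin> A" by (simp add: r_def prob_eq_0)
  with AE_convergent_W_seq show ?thesis
    by eventually_elim (use W_nonneg in \<open>force simp: A_def\<close>)
qed

end


section \<open>Averages over a generation\<close>

text \<open>Geometric sums on the two sides of the first power of \<open>b\<close> that reaches
  \<open>x\<close>. Applied to a random \<open>x\<close> and integrated, they bound the sum of b^n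
  P(X > b^n) and the sum of b^-n E(X^2; X \<le> b^n) by a multiple of the mean of X.\<close>

lemma truncation_sums:
  fixes b x :: real
  assumes b: "1 < b" and x: "0 \<le> x"
  shows "(\<Sum>n. ennreal (if b ^ n < x then b ^ n else 0)) \<le> ennreal (b / (b - 1) * x)"
    and "(\<Sum>n. ennreal ((if x \<le> b ^ n then x else 0)\<^sup>2 / b ^ n)) \<le> ennreal (b / (b - 1) * x)"
proof -
  define j where "j = (LEAST n. x \<le> b ^ n)"
  have "\<exists>n. x \<le> b ^ n" using real_arch_pow[OF b, of x] by (auto intro: less_imp_le)
  then have j: "x \<le> b ^ j" unfolding j_def by (rule LeastI_ex)
  have j_iff: "x \<le> b ^ n \<longleftrightarrow> j \<le> n" for n
    using j b power_increasing[of j n b] by (auto simp: j_def intro: Least_le order_trans)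
  have "(\<Sum>n. ennreal (if b ^ n < x then b ^ n else 0)) = (\<Sum>n<j. ennreal (if b ^ n < x then b ^ n else 0))"
    by (rule suminf_finite) (use j_iff in \<open>auto simp: not_less[symmetric]\<close>)
  also have "\<dots> = (\<Sum>n<j. ennreal (b ^ n))"
    by (intro sum.cong refl) (use j_iff in \<open>auto simp: not_less[symmetric]\<close>)
  also have "\<dots> = ennreal ((b ^ j - 1) / (b - 1))"
    using b by (simp add: sum_ennreal geometric_sum)
  also have "\<dots> \<le> ennreal (b / (b - 1) * x)"
  proof (rule ennreal_leI)
    \<comment> \<open>The power before the first one reaching \<open>x\<close> is still at most
      \<open>x\<close>; for j = 0 the left side is 0.\<close>
    have "b ^ j - 1 \<le> b * x"
    proof (cases j)
      case (Suc i)
      then have "b ^ i \<le> x" using j_iff[of i] by simp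
      then have "b * b ^ i \<le> b * x" using b by (intro mult_left_mono) auto
      then show ?thesis using Suc by simp
    qed (use b x in simp)
    then show "(b ^ j - 1) / (b - 1) \<le> b / (b - 1) * x"
      using b by (simp add: divide_right_mono)
  qed
  finally show "(\<Sum>n. ennreal (if b ^ n < x then b ^ n else 0)) \<le> ennreal (b / (b - 1) * x)" .
  let ?f = "\<lambda>n. (if x \<le> b ^ n then x else 0)\<^sup>2 / b ^ n"
  have "(\<lambda>n. (x\<^sup>2 / b ^ j) * (1 / b) ^ n) sums ((x\<^sup>2 / b ^ j) * (1 / (1 - 1 / b)))"
    using b by (intro sums_mult geometric_sums) simp
  moreover have "?f (n + j) = (x\<^sup>2 / b ^ j) * (1 / b) ^ n" for n
    using j_iff[of "n + j"] by (simp add: power_add power_one_over field_simps)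
  ultimately have "(\<lambda>n. ?f (n + j)) sums ((x\<^sup>2 / b ^ j) * (1 / (1 - 1 / b)))" by simp
  moreover have "(\<Sum>n<j. ?f n) = 0" using j_iff by (intro sum.neutral) auto
  ultimately have sums: "?f sums ((x\<^sup>2 / b ^ j) * (1 / (1 - 1 / b)))"
    by (subst (asm) sums_iff_shift) simp
  have "(\<Sum>n. ennreal (?f n)) = ennreal ((x\<^sup>2 / b ^ j) * (1 / (1 - 1 / b)))"
    using sums b by (subst suminf_ennreal2) (auto simp: sums_iff)
  also have "\<dots> \<le> ennreal (b / (b - 1) * x)"
  proof (rule ennreal_leI)
    have "x * (x / b ^ j) \<le> x * 1"
      using j b x by (intro mult_left_mono) (auto simp: divide_le_eq)
    then have "x\<^sup>2 / b ^ j \<le> x" by (simp add: power2_eq_square)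
    then have "(x\<^sup>2 / b ^ j) * (b / (b - 1)) \<le> x * (b / (b - 1))"
      using b by (intro mult_right_mono) auto
    moreover have "1 / (1 - 1 / b) = b / (b - 1)" using b by (simp add: field_simps)
    ultimately show "(x\<^sup>2 / b ^ j) * (1 / (1 - 1 / b)) \<le> b / (b - 1) * x"
      by (simp add: mult.commute)
  qed
  finally show "(\<Sum>n. ennreal (?f n)) \<le> ennreal (b / (b - 1) * x)" .
qed

lemma branch_sum_cong:
  "(\<And>i. i < N [] \<Longrightarrow> g (subcounts i N) = h (subcounts i N)) \<Longrightarrow> branch_sum g N = branch_sum h N"
  by (simp add: branch_sum_def)

lemma AE_finite_of_nn_integral_finite:
  assumes "f \<in> borel_measurable M" and "(\<integral>\<^sup>+ x. f x \<partial>M) < \<infinity>"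
  shows "AE x in M. f x < \<infinity>"
  using nn_integral_PInf_AE[of f M] assms by (auto simp: less_top)

text \<open>Wherever \<open>g\<close> and \<open>h\<close> differ, \<open>e\<close> is at least 1. A
  level sum of \<open>e\<close> below 1 therefore means that they agree on all subtrees at that
  level.\<close>

lemma branch_sum_iter_cong_small:
  fixes e :: "_ \<Rightarrow> ennreal"
  assumes "\<And>N. e N < 1 \<Longrightarrow> g N = h N"
  shows "(branch_sum ^^ n) e N < 1 \<Longrightarrow> (branch_sum ^^ n) g N = (branch_sum ^^ n) h N"
proof (induction n arbitrary: N)
  case (Suc n)
  have "(branch_sum ^^ n) e (subcounts i N) < 1" if "i < N []" for i
  proof -
    have "(branch_sum ^^ n) e (subcounts i N) \<le> (branch_sum ^^ Suc n) e N"
      using that member_le_sum[of i "{..<N []}" "\<lambda>i. (branch_sum ^^ n) e (subcounts i N)"]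
      by (simp add: branch_sum_def)
    then show ?thesis using Suc.prems by (rule le_less_trans)
  qed
  then show ?case by (auto intro!: branch_sum_cong Suc.IH)
qed (simp add: assms)

lemma suminf_ennreal_finite_imp_bounded:
  fixes a :: "nat \<Rightarrow> ennreal"
  assumes "(\<Sum>n. a n) < \<infinity>"
  obtains K where "0 \<le> K" "\<And>n. a n \<le> ennreal K"
proof -
  obtain K where K: "0 \<le> K" "(\<Sum>n. a n) = ennreal K"
    using assms by (cases "\<Sum>n. a n") auto
  have "a n \<le> ennreal K" for n
    using sum_le_suminf[OF summableI, of "{n}" a] K by simp
  with K(1) show ?thesis using that by blast
qed

lemma suminf_ennreal_finite_imp_eventually_small:
  fixes a :: "nat \<Rightarrow> ennreal"
  assumes "(\<Sum>n. a n) < \<infinity>"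
  shows "\<forall>\<^sub>F n in sequentially. a n < 1"
proof -
  obtain K where K: "0 \<le> K" "\<And>n. a n \<le> ennreal K"
    using suminf_ennreal_finite_imp_bounded[OF assms] by blast
  have a: "a n = ennreal (enn2real (a n))" for n
    using K(2)[of n] by (metis ennreal_enn2real ennreal_less_top le_less_trans)
  have "summable (\<lambda>n. enn2real (a n))"
    by (rule summable_suminf_not_top) (use assms in \<open>simp_all flip: a\<close>)
  then have "(\<lambda>n. enn2real (a n)) \<longlonglongrightarrow> 0" by (rule summable_LIMSEQ_zero)
  then have "\<forall>\<^sub>F n in sequentially. enn2real (a n) < 1" by (rule order_tendstoD) simp
  then show ?thesis
    by eventually_elim (metis a enn2real_nonneg ennreal_1 ennreal_less_iff)
qed

context offspring begin

text \<open>At level \<open>n\<close>, \<open>X\<close> is cut off at \<open>m ^ n\<close>. The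
  count \<open>e n\<close> of subtrees affected by the cut vanishes for large \<open>n\<close>, the
  centred part \<open>g n\<close> has summable normalised second moments, and the mean part is
  \<open>\<mu> n * W_seq n N\<close>, bounded because the martingale converges.\<close>

lemma AE_bounded_branch_average:
  fixes X :: "(nat list \<Rightarrow> nat) \<Rightarrow> real"
  assumes X: "integrable \<Omega> X" and X0: "\<And>N. 0 \<le> X N"
  shows "AE N in \<Omega>. Bseq (\<lambda>n. (branch_sum ^^ n) X N / m ^ n)"
proof -
  have [measurable]: "X \<in> borel_measurable \<Omega>" using X by auto
  define t where "t n N = (if X N \<le> m ^ n then X N else 0)" for n N
  define e where "e n N = (if m ^ n < X N then 1 else 0 :: ennreal)" for n N
  define \<mu> where "\<mu> n = expectation (t n)" for n
  define g where "g n N = t n N - \<mu> n" for n N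
  have [measurable]: "t n \<in> borel_measurable \<Omega>" "e n \<in> borel_measurable \<Omega>" for n
    unfolding t_def e_def by measurable
  then have [measurable]: "g n \<in> borel_measurable \<Omega>" for n
    unfolding g_def by measurable
  have t0: "0 \<le> t n N" and tX: "t n N \<le> X N" and tm: "t n N \<le> m ^ n" for n N
    using X0 m_pos by (auto simp: t_def)
  have int_t: "integrable \<Omega> (t n)" for n
    by (rule Bochner_Integration.integrable_bound[OF X]) (use t0 tX X0 in auto)
  have int_t2: "integrable \<Omega> (\<lambda>N. (t n N)\<^sup>2)" for n
  proof (rule integrable_const_bound)
    show "AE N in \<Omega>. norm ((t n N)\<^sup>2) \<le> (m ^ n)\<^sup>2"
      using t0 tm by (auto intro!: power_mono)
  qed measurable
  have \<mu>: "0 \<le> \<mu> n" "\<mu> n \<le> expectation X" for n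
    unfolding \<mu>_def using t0 tX
    by (auto intro!: Bochner_Integration.integral_nonneg integral_mono int_t X)
  have g: "integrable \<Omega> (g n)" "expectation (g n) = 0" "integrable \<Omega> (\<lambda>N. (g n N)\<^sup>2)" for n
  proof -
    show "integrable \<Omega> (g n)" unfolding g_def using int_t by simp
    show "expectation (g n) = 0" unfolding g_def using int_t prob_space by (simp add: \<mu>_def)
    show "integrable \<Omega> (\<lambda>N. (g n N)\<^sup>2)"
      unfolding g_def power2_diff using int_t int_t2 by simp
  qed
  \<comment> \<open>Centring can only decrease the second moment.\<close>
  have var: "(\<integral>\<^sup>+ N. ennreal ((g n N)\<^sup>2) \<partial>\<Omega>) \<le> (\<integral>\<^sup>+ N. ennreal ((t n N)\<^sup>2) \<partial>\<Omega>)" for n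
  proof -
    have "expectation (\<lambda>N. (g n N)\<^sup>2) = expectation (\<lambda>N. (t n N)\<^sup>2) - (\<mu> n)\<^sup>2"
      using variance_eq[OF int_t int_t2, of n] by (simp add: g_def \<mu>_def)
    then show ?thesis
      using nn_integral_eq_integral[OF g(3)] nn_integral_eq_integral[OF int_t2]
      by (simp add: ennreal_leI)
  qed
  define C where "C = m / (m - 1)"
  have C: "0 \<le> C" using mean_gt_1 by (simp add: C_def)
  have finX: "(\<integral>\<^sup>+ N. ennreal (C * X N) \<partial>\<Omega>) < \<infinity>"
    using nn_integral_eq_integral[of \<Omega> "\<lambda>N. C * X N"] X X0 C by simp
  have "(\<integral>\<^sup>+ N. (\<Sum>n. (branch_sum ^^ n) (e n) N) \<partial>\<Omega>) < \<infinity>"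
  proof -
    have "(\<integral>\<^sup>+ N. (\<Sum>n. (branch_sum ^^ n) (e n) N) \<partial>\<Omega>)
        = (\<Sum>n. ennreal m ^ n * (\<integral>\<^sup>+ N. e n N \<partial>\<Omega>))"
      by (simp add: nn_integral_suminf nn_integral_branch_sum_iter)
    also have "\<dots> = (\<integral>\<^sup>+ N. (\<Sum>n. ennreal m ^ n * e n N) \<partial>\<Omega>)"
      by (simp add: nn_integral_suminf nn_integral_cmult)
    also have "\<dots> = (\<integral>\<^sup>+ N. (\<Sum>n. ennreal (if m ^ n < X N then m ^ n else 0)) \<partial>\<Omega>)"
      using m_pos by (intro nn_integral_cong suminf_cong) (simp add: e_def ennreal_power)
    also have "\<dots> \<le> (\<integral>\<^sup>+ N. ennreal (C * X N) \<partial>\<Omega>)"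
      unfolding C_def by (intro nn_integral_mono truncation_sums mean_gt_1 X0)
    finally show ?thesis using finX by (rule le_less_trans)
  qed
  \<comment> \<open>The expected number of affected subtrees at level \<open>n\<close> is m^n P(X >
    m^n); the first truncation bound sums these.\<close>
  then have AE1: "AE N in \<Omega>. (\<Sum>n. (branch_sum ^^ n) (e n) N) < \<infinity>"
    by (intro AE_finite_of_nn_integral_finite) measurable
  have "(\<integral>\<^sup>+ N. (\<Sum>n. ennreal (((branch_sum ^^ n) (g n) N / m ^ n)\<^sup>2)) \<partial>\<Omega>) < \<infinity>"
  proof -
    have "(\<integral>\<^sup>+ N. ennreal (((branch_sum ^^ n) (g n) N / m ^ n)\<^sup>2) \<partial>\<Omega>)
        \<le> (\<integral>\<^sup>+ N. ennreal ((t n N)\<^sup>2 / m ^ n) \<partial>\<Omega>)" for n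
    proof -
      have "(\<integral>\<^sup>+ N. ennreal (((branch_sum ^^ n) (g n) N / m ^ n)\<^sup>2) \<partial>\<Omega>)
          = (\<integral>\<^sup>+ N. ennreal (1 / (m ^ n)\<^sup>2) * ennreal (((branch_sum ^^ n) (g n) N)\<^sup>2) \<partial>\<Omega>)"
        by (simp add: power_divide flip: ennreal_mult')
      also have "\<dots> = ennreal (1 / (m ^ n)\<^sup>2) * (ennreal (m ^ n) * (\<integral>\<^sup>+ N. ennreal ((g n N)\<^sup>2) \<partial>\<Omega>))"
        using branch_sum_iter_centred[OF g, of n] m_pos
        by (subst nn_integral_cmult) (simp_all add: ennreal_power)
      also have "\<dots> = ennreal (1 / m ^ n) * (\<integral>\<^sup>+ N. ennreal ((g n N)\<^sup>2) \<partial>\<Omega>)"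
        using m_pos by (simp add: mult.assoc[symmetric] power2_eq_square flip: ennreal_mult')
      also have "\<dots> \<le> ennreal (1 / m ^ n) * (\<integral>\<^sup>+ N. ennreal ((t n N)\<^sup>2) \<partial>\<Omega>)"
        by (intro mult_left_mono var) simp
      also have "\<dots> = (\<integral>\<^sup>+ N. ennreal ((t n N)\<^sup>2 / m ^ n) \<partial>\<Omega>)"
        using m_pos by (subst nn_integral_cmult[symmetric]) (simp_all flip: ennreal_mult')
      finally show ?thesis .
    qed
    then have "(\<integral>\<^sup>+ N. (\<Sum>n. ennreal (((branch_sum ^^ n) (g n) N / m ^ n)\<^sup>2)) \<partial>\<Omega>)
        \<le> (\<Sum>n. \<integral>\<^sup>+ N. ennreal ((t n N)\<^sup>2 / m ^ n) \<partial>\<Omega>)"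
      by (subst nn_integral_suminf) (auto intro!: suminf_le)
    also have "\<dots> = (\<integral>\<^sup>+ N. (\<Sum>n. ennreal ((t n N)\<^sup>2 / m ^ n)) \<partial>\<Omega>)"
      by (simp add: nn_integral_suminf)
    also have "\<dots> \<le> (\<integral>\<^sup>+ N. ennreal (C * X N) \<partial>\<Omega>)"
      unfolding C_def t_def by (intro nn_integral_mono truncation_sums mean_gt_1 X0)
    finally show ?thesis using finX by (rule le_less_trans)
  qed
  \<comment> \<open>The mean at level \<open>n\<close> is at most the second moment of
    \<open>t n\<close> divided by \<open>m ^ n\<close>; the second truncation bound sums
    these.\<close>
  then have AE2: "AE N in \<Omega>. (\<Sum>n. ennreal (((branch_sum ^^ n) (g n) N / m ^ n)\<^sup>2)) < \<infinity>"
    by (intro AE_finite_of_nn_integral_finite) measurable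
  show ?thesis
    using AE1 AE2 AE_convergent_W_seq
  proof eventually_elim
    case (elim N)
    \<comment> \<open>The first Borel-Cantelli argument in summed form: counts with a finite sum are
      eventually below 1.\<close>
    from suminf_ennreal_finite_imp_eventually_small[OF elim(1)]
    have ev: "\<forall>\<^sub>F n in sequentially. (branch_sum ^^ n) X N = (branch_sum ^^ n) (t n) N"
    proof eventually_elim
      case (elim n)
      show ?case
        by (rule branch_sum_iter_cong_small[OF _ elim]) (auto simp: e_def t_def split: if_splits)
    qed
    obtain K where K: "0 \<le> K" "\<And>n. ((branch_sum ^^ n) (g n) N / m ^ n)\<^sup>2 \<le> K"
      using suminf_ennreal_finite_imp_bounded[OF elim(2)] by (metis ennreal_le_iff)
    obtain B where B: "\<And>n. \<bar>W_seq n N\<bar> \<le> B"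
      using convergent_imp_Bseq[OF elim(3)] by (auto simp: Bseq_def)
    have bound: "norm ((branch_sum ^^ n) (t n) N / m ^ n) \<le> sqrt K + expectation X * B" for n
    proof -
      \<comment> \<open>The factor 1 exhibits the mean part as a multiple of the constant function,
        whose level sum is the generation size.\<close>
      have "t n = (\<lambda>N. g n N + \<mu> n * 1)" by (auto simp: g_def)
      then have "(branch_sum ^^ n) (t n) N = (branch_sum ^^ n) (g n) N + \<mu> n * (branch_sum ^^ n) (\<lambda>_. 1) N"
        by (simp only: branch_sum_iter_add branch_sum_iter_mult)
      then have "(branch_sum ^^ n) (t n) N / m ^ n = (branch_sum ^^ n) (g n) N / m ^ n + \<mu> n * W_seq n N"
        by (simp add: W_seq_def add_divide_distrib)
      also have "\<bar>\<dots>\<bar> \<le> \<bar>(branch_sum ^^ n) (g n) N / m ^ n\<bar> + \<mu> n * \<bar>W_seq n N\<bar>"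
        using \<mu>(1)[of n] by (metis abs_mult abs_of_nonneg abs_triangle_ineq)
      also have "\<dots> \<le> sqrt K + expectation X * B"
      proof (intro add_mono mult_mono)
        show "\<bar>(branch_sum ^^ n) (g n) N / m ^ n\<bar> \<le> sqrt K"
          using K(2)[of n] real_sqrt_le_mono by fastforce
      qed (use \<mu>[of n] B in \<open>auto intro: order_trans\<close>)
      finally show ?thesis by simp
    qed
    have "Bseq (\<lambda>n. (branch_sum ^^ n) (t n) N / m ^ n)"
      by (rule BseqI') (rule bound)
    then show ?case
      by (rule Bseq_eventually_mono[rotated]) (use ev in eventually_elim, simp)
  qed
qed

end


section \<open>From offspring counts to trees\<close>

definition subtree_counts :: "nat list \<Rightarrow> (nat list \<Rightarrow> nat) \<Rightarrow> nat list \<Rightarrow> nat" where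
  "subtree_counts v N = (\<lambda>u. N (v @ u))"

definition level :: "nat list set \<Rightarrow> nat \<Rightarrow> nat list set" where
  "level \<Gamma> n = {v \<in> \<Gamma>. length v = n}"

lemma subtree_counts_Nil [simp]: "subtree_counts [] N = N"
  and subtree_counts_Cons: "subtree_counts (i # v) N = subtree_counts v (subcounts i N)"
  and subcounts_subtree_counts: "subcounts i (subtree_counts v N) = subtree_counts (v @ [i]) N"
  by (simp_all add: subtree_counts_def subcounts_def)

lemma Cons_in_tree_of_counts:
  "i # v \<in> tree_of_counts N \<longleftrightarrow> i < N [] \<and> v \<in> tree_of_counts (subcounts i N)"
  by (auto simp: tree_of_counts_def subcounts_def less_Suc_eq_0_disj)

lemma append_in_tree_of_counts:
  "v \<in> tree_of_counts N \<Longrightarrow> v @ u \<in> tree_of_counts N \<longleftrightarrow> u \<in> tree_of_counts (subtree_counts v N)"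
  by (induction v arbitrary: N) (auto simp: Cons_in_tree_of_counts subtree_counts_Cons)

lemma level_0_tree_of_counts: "level (tree_of_counts N) 0 = {[]}"
  by (auto simp: level_def Nil_in_tree_of_counts)

lemma level_Suc_tree_of_counts:
  "level (tree_of_counts N) (Suc n) = (\<Union>i<N []. (#) i ` level (tree_of_counts (subcounts i N)) n)"
  by (auto simp: level_def length_Suc_conv Cons_in_tree_of_counts)

lemma finite_level_tree_of_counts: "finite (level (tree_of_counts N) n)"
  by (induction n arbitrary: N) (simp_all add: level_0_tree_of_counts level_Suc_tree_of_counts)

text \<open>Links the recursive sums of the probabilistic part with sums over the vertices of a
  tree; level \<open>n + 1\<close> is sorted by the first letter.\<close>

lemma branch_sum_iter_eq_sum_level:
  "(branch_sum ^^ n) g N = (\<Sum>v\<in>level (tree_of_counts N) n. g (subtree_counts v N))"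
proof (induction n arbitrary: N)
  case 0
  then show ?case by (simp add: level_0_tree_of_counts)
next
  case (Suc n)
  let ?L = "\<lambda>i. level (tree_of_counts (subcounts i N)) n"
  have "(\<Sum>v\<in>level (tree_of_counts N) (Suc n). g (subtree_counts v N))
      = (\<Sum>i<N []. \<Sum>v\<in>(#) i ` ?L i. g (subtree_counts v N))"
    unfolding level_Suc_tree_of_counts
    by (rule sum.UNION_disjoint) (auto simp: finite_level_tree_of_counts)
  also have "\<dots> = (\<Sum>i<N []. \<Sum>v\<in>?L i. g (subtree_counts v (subcounts i N)))"
    by (rule sum.cong[OF refl], subst sum.reindex) (simp_all add: subtree_counts_Cons)
  also have "\<dots> = (\<Sum>i<N []. (branch_sum ^^ n) g (subcounts i N))"
    by (simp add: Suc.IH)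
  also have "\<dots> = (branch_sum ^^ Suc n) g N"
    by (simp add: branch_sum_def[of "(branch_sum ^^ n) g"])
  finally show ?case by (rule sym)
qed

text \<open>The labels of the children form a finite, downward closed set of naturals, hence an
  initial segment, whose length is its cardinality.\<close>

lemma rooted_tree_child_iff:
  assumes "rooted_tree \<Gamma>"
  shows "i < num_children \<Gamma> v \<longleftrightarrow> v @ [i] \<in> \<Gamma>"
proof -
  let ?S = "{i. v @ [i] \<in> \<Gamma>}"
  have fin: "finite ?S" and down: "\<And>i j. j \<in> ?S \<Longrightarrow> i < j \<Longrightarrow> i \<in> ?S"
    using assms unfolding rooted_tree_def by blast+
  obtain n where "?S = {..<n}"
  proof (cases "?S = {}")
    case True
    then show ?thesis using that[of 0] by simp
  next
    case False
    have "?S = {..<Suc (Max ?S)}"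
    proof (intro set_eqI iffI)
      fix i assume "i \<in> {..<Suc (Max ?S)}"
      then have "i = Max ?S \<or> i < Max ?S" by auto
      then show "i \<in> ?S" using Max_in[OF fin False] down by metis
    qed (use Max_ge[OF fin] in \<open>auto simp: less_Suc_eq_le\<close>)
    then show ?thesis by (rule that)
  qed
  then show ?thesis unfolding num_children_def by auto
qed

lemma tree_of_counts_num_children:
  assumes "rooted_tree \<Gamma>"
  shows "tree_of_counts (num_children \<Gamma>) = \<Gamma>"
proof (rule set_eqI)
  fix v
  have pre: "v @ [i] \<in> \<Gamma> \<Longrightarrow> v \<in> \<Gamma>" "[] \<in> \<Gamma>" for v i
    using assms by (auto simp: rooted_tree_def)
  show "v \<in> tree_of_counts (num_children \<Gamma>) \<longleftrightarrow> v \<in> \<Gamma>"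
    by (induction v rule: rev_induct)
      (use pre in \<open>auto simp: Nil_in_tree_of_counts snoc_in_tree_of_counts rooted_tree_child_iff[OF assms]\<close>)
qed

lemma measurable_num_children [measurable]:
  "num_children \<in> tree_space \<rightarrow>\<^sub>M counts_measure q"
proof (rule measurable_into_counts_measure)
  have "{\<Gamma>. rooted_tree \<Gamma> \<and> u \<in> \<Gamma>} \<in> sets tree_space" for u
    unfolding tree_space_def by (subst sets_measure_of) auto
  then have "{\<Gamma> \<in> space tree_space. i \<in> {i. v @ [i] \<in> \<Gamma>}} \<in> sets tree_space" for i v
    by (simp add: space_tree_space)
  then show "(\<lambda>\<Gamma>. num_children \<Gamma> v) \<in> tree_space \<rightarrow>\<^sub>M count_space UNIV" for v
    unfolding num_children_def by (rule measurable_card)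
qed

text \<open>
  The invariance assumption is what makes the property measurable on \<open>tree_space\<close>: there the
  measurable map \<open>num_children\<close> forgets the counts at words outside the tree.
\<close>

lemma AE_galton_watsonI:
  assumes AE: "AE N in counts_measure q. P N"
    and [measurable]: "Measurable.pred (counts_measure q) P"
    and inv: "\<And>N N'. tree_of_counts N = tree_of_counts N' \<Longrightarrow> P N \<Longrightarrow> P N'"
  shows "AE \<Gamma> in galton_watson q. P (num_children \<Gamma>)"
  unfolding galton_watson_def
proof (subst AE_distr_iff)
  show "tree_of_counts \<in> counts_measure q \<rightarrow>\<^sub>M tree_space" by measurable
  show "{\<Gamma> \<in> space tree_space. P (num_children \<Gamma>)} \<in> sets tree_space" by measurable
  show "AE N in counts_measure q. P (num_children (tree_of_counts N))"
    using AE
  proof eventually_elim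
    case (elim N)
    show ?case
      by (rule inv[OF _ elim]) (simp add: tree_of_counts_num_children rooted_tree_tree_of_counts)
  qed
qed

lemma tree_of_counts_subtree_counts_cong:
  assumes "tree_of_counts N = tree_of_counts N'" "v \<in> tree_of_counts N"
  shows "tree_of_counts (subtree_counts v N) = tree_of_counts (subtree_counts v N')"
  using assms append_in_tree_of_counts[of v N] append_in_tree_of_counts[of v N'] by auto

lemma branch_sum_iter_tree_cong:
  assumes "tree_of_counts N = tree_of_counts N'"
    and "\<And>N N'. tree_of_counts N = tree_of_counts N' \<Longrightarrow> g N = g N'"
  shows "(branch_sum ^^ n) g N = (branch_sum ^^ n) g N'"
  unfolding branch_sum_iter_eq_sum_level assms(1)[symmetric]
  by (intro sum.cong refl assms(2) tree_of_counts_subtree_counts_cong assms(1)) (simp add: level_def)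

text \<open>A flow from the root of arbitrary positive strength whose sums of squares decay like
  \<open>m ^ -n\<close>: all that the random tree has to supply for positive capacity.\<close>

definition tame_flow :: "real \<Rightarrow> nat list set \<Rightarrow> (nat list \<Rightarrow> real) \<Rightarrow> real \<Rightarrow> bool" where
  "tame_flow m \<Gamma> w C \<longleftrightarrow>
     0 < w [] \<and> (\<forall>v\<in>\<Gamma>. 0 \<le> w v \<and> w v = (\<Sum>i<num_children \<Gamma> v. w (v @ [i]))) \<and>
     (\<forall>n. (\<Sum>v\<in>level \<Gamma> n. (w v)\<^sup>2) \<le> C / m ^ n)"

section \<open>Almost sure existence of a tame flow\<close>

context offspring begin

text \<open>Convergence is demanded at vertices of the tree only, so that the property depends on
  \<open>tree_of_counts N\<close> alone. The bound is a natural number so that the quantifier over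
  it is countable and the property measurable.\<close>

definition good_counts :: "(nat list \<Rightarrow> nat) \<Rightarrow> bool" where
  "good_counts N \<longleftrightarrow>
     (\<forall>v. v \<in> tree_of_counts N \<longrightarrow> convergent (\<lambda>n. W_seq n (subtree_counts v N))) \<and>
     0 < W N \<and>
     (\<exists>K::nat. \<forall>n. (branch_sum ^^ n) (\<lambda>N. (W N)\<^sup>2) N / m ^ n \<le> real K)"

lemma measurable_subtree_counts [measurable]:
  "subtree_counts v \<in> \<Omega> \<rightarrow>\<^sub>M \<Omega>"
  unfolding subtree_counts_def by (rule measurable_into_counts_measure) measurable

lemma AE_subtree_counts:
  assumes "AE N in \<Omega>. P N"
  shows "AE N in \<Omega>. P (subtree_counts v N)"
proof (induction v)
  case (Cons i v)
  from AE_subcounts[OF Cons.IH] show ?case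
    by eventually_elim (simp add: subtree_counts_Cons)
qed (simp add: assms)

lemma AE_good_counts: "AE N in \<Omega>. good_counts N"
proof -
  have conv: "AE N in \<Omega>. \<forall>v. convergent (\<lambda>n. W_seq n (subtree_counts v N))"
    using AE_subtree_counts[OF AE_convergent_W_seq] by (simp add: AE_all_countable)
  have "AE N in \<Omega>. Bseq (\<lambda>n. (branch_sum ^^ n) (\<lambda>N. (W N)\<^sup>2) N / m ^ n)"
    by (rule AE_bounded_branch_average[OF integrable_W_square]) simp
  with conv AE_W_pos show ?thesis
  proof eventually_elim
    case (elim N)
    from elim(3) obtain B where B: "\<And>n. norm ((branch_sum ^^ n) (\<lambda>N. (W N)\<^sup>2) N / m ^ n) \<le> B"
      unfolding Bseq_def by blast
    have "(branch_sum ^^ n) (\<lambda>N. (W N)\<^sup>2) N / m ^ n \<le> real (nat \<lceil>B\<rceil>)" for n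
      using B[of n] real_nat_ceiling_ge[of B] unfolding real_norm_def by linarith
    with elim show ?case unfolding good_counts_def by blast
  qed
qed

lemma measurable_good_counts [measurable]: "Measurable.pred \<Omega> good_counts"
proof -
  have [measurable]: "Measurable.pred \<Omega> (\<lambda>N. v \<in> tree_of_counts N)" for v
    unfolding tree_of_counts_def by simp measurable
  have [measurable]: "Measurable.pred \<Omega> (\<lambda>N. convergent (\<lambda>n. W_seq n (subtree_counts v N)))" for v
  proof -
    have "(\<lambda>N. W_seq n (subtree_counts v N)) \<in> borel_measurable \<Omega>" for n
      by (rule measurable_compose[OF measurable_subtree_counts measurable_W_seq])
    from sets_Collect_Cauchy[OF this] show ?thesis
      by (simp add: pred_def Cauchy_convergent_iff)
  qed
  show ?thesis unfolding good_counts_def by measurable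
qed

lemma W_seq_tree_cong:
  "tree_of_counts N = tree_of_counts N' \<Longrightarrow> W_seq n N = W_seq n N'"
  unfolding W_seq_def by (rule arg_cong[where f = "\<lambda>x. x / m ^ n"], rule branch_sum_iter_tree_cong) auto

lemma W_tree_cong: "tree_of_counts N = tree_of_counts N' \<Longrightarrow> W N = W N'"
  unfolding W_def by (rule arg_cong[where f = lim]) (intro ext W_seq_tree_cong)

lemma good_counts_tree_cong:
  assumes T: "tree_of_counts N = tree_of_counts N'" and "good_counts N"
  shows "good_counts N'"
proof -
  have "(branch_sum ^^ n) (\<lambda>N. (W N)\<^sup>2) N' = (branch_sum ^^ n) (\<lambda>N. (W N)\<^sup>2) N" for n
    by (rule branch_sum_iter_tree_cong[OF T[symmetric]])
      (rule arg_cong[where f = "\<lambda>x. x\<^sup>2"], rule W_tree_cong)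
  moreover have "W N' = W N" by (rule W_tree_cong[OF T[symmetric]])
  moreover have "W_seq n (subtree_counts v N') = W_seq n (subtree_counts v N)"
    if "v \<in> tree_of_counts N'" for v n
    by (rule W_seq_tree_cong, rule tree_of_counts_subtree_counts_cong[OF T[symmetric] that])
  ultimately show ?thesis
    using assms by (simp add: good_counts_def)
qed

text \<open>The flow at \<open>v\<close> is \<open>W\<close> of the subtree at \<open>v\<close>
  divided by \<open>m ^ length v\<close>. Its conservation law is \<open>W_rec\<close>, its squares
  are controlled by \<open>K\<close>, and boundedness of \<open>W_seq\<close> controls the level
  sizes; \<open>C\<close> is the larger of the two bounds.\<close>

lemma good_counts_tame_flow:
  assumes \<Gamma>: "rooted_tree \<Gamma>" and good: "good_counts (num_children \<Gamma>)"
  shows "\<exists>C w. (\<forall>n. finite (level \<Gamma> n) \<and> real (card (level \<Gamma> n)) \<le> C * m ^ n) \<and> tame_flow m \<Gamma> w C"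
proof -
  define N where "N = num_children \<Gamma>"
  have T: "tree_of_counts N = \<Gamma>"
    unfolding N_def by (rule tree_of_counts_num_children[OF \<Gamma>])
  have conv: "convergent (\<lambda>n. W_seq n (subtree_counts v N))" if "v \<in> \<Gamma>" for v
    using good that T by (simp add: good_counts_def N_def)
  have nil: "[] \<in> \<Gamma>" using \<Gamma> by (simp add: rooted_tree_def)
  obtain K :: nat where K: "\<And>n. (branch_sum ^^ n) (\<lambda>N. (W N)\<^sup>2) N / m ^ n \<le> real K"
    using good unfolding good_counts_def N_def by blast
  obtain B where B: "\<And>n. \<bar>W_seq n N\<bar> \<le> B"
    using convergent_imp_Bseq[OF conv[OF nil]] by (auto simp: Bseq_def)
  define C where "C = max (real K) B"
  define w where "w v = W (subtree_counts v N) / m ^ length v" for v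
  have "real (card (level \<Gamma> n)) \<le> C * m ^ n" for n
  proof -
    have "real (card (level \<Gamma> n)) / m ^ n \<le> C"
      using B[of n] m_pos by (simp add: W_seq_def branch_sum_iter_eq_sum_level T C_def)
    then show ?thesis using m_pos by (simp add: divide_le_eq)
  qed
  moreover have "tame_flow m \<Gamma> w C"
    unfolding tame_flow_def
  proof (intro conjI ballI allI)
    show "0 < w []" using good by (simp add: w_def good_counts_def N_def)
    fix v assume v: "v \<in> \<Gamma>"
    show "0 \<le> w v" unfolding w_def using W_nonneg[OF conv[OF v]] m_pos by simp
    have child: "v @ [i] \<in> \<Gamma>" if "i < N v" for i
      using that rooted_tree_child_iff[OF \<Gamma>] by (simp add: N_def)
    have root: "subtree_counts v N [] = N v" by (simp add: subtree_counts_def)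
    have "W (subtree_counts v N) = branch_sum W (subtree_counts v N) / m"
      by (rule W_rec) (auto simp: subcounts_subtree_counts root intro!: conv v child)
    then show "w v = (\<Sum>i<num_children \<Gamma> v. w (v @ [i]))"
      by (simp add: w_def branch_sum_def root subcounts_subtree_counts N_def[symmetric]
          sum_divide_distrib[symmetric])
  next
    fix n
    have "(\<Sum>v\<in>level \<Gamma> n. (w v)\<^sup>2) = (\<Sum>v\<in>level \<Gamma> n. (W (subtree_counts v N))\<^sup>2) / (m ^ n)\<^sup>2"
      by (simp add: w_def level_def power_divide sum_divide_distrib)
    also have "\<dots> = (branch_sum ^^ n) (\<lambda>N. (W N)\<^sup>2) N / m ^ n / m ^ n"
      by (simp add: branch_sum_iter_eq_sum_level T power2_eq_square)
    also have "\<dots> \<le> C / m ^ n"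
      using K[of n] m_pos by (intro divide_right_mono) (auto simp: C_def)
    finally show "(\<Sum>v\<in>level \<Gamma> n. (w v)\<^sup>2) \<le> C / m ^ n" .
  qed
  ultimately show ?thesis
    using finite_level_tree_of_counts[of N] T by auto
qed

lemma AE_tame_flow:
  "AE \<Gamma> in galton_watson q. rooted_tree \<Gamma> \<and>
     (\<exists>C w. (\<forall>n. finite (level \<Gamma> n) \<and> real (card (level \<Gamma> n)) \<le> C * m ^ n) \<and> tame_flow m \<Gamma> w C)"
proof -
  have "AE \<Gamma> in galton_watson q. good_counts (num_children \<Gamma>)"
    by (rule AE_galton_watsonI[OF AE_good_counts measurable_good_counts good_counts_tree_cong])
  then show ?thesis
  proof (rule AE_mp, intro AE_I2 impI conjI)
    fix \<Gamma> assume "\<Gamma> \<in> space (galton_watson q)"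
    then show "rooted_tree \<Gamma>" by (simp add: galton_watson_def space_tree_space)
    then show "\<exists>C w. (\<forall>n. finite (level \<Gamma> n) \<and> real (card (level \<Gamma> n)) \<le> C * m ^ n) \<and> tame_flow m \<Gamma> w C"
      if "good_counts (num_children \<Gamma>)"
      using that by (rule good_counts_tame_flow)
  qed
qed

end


section \<open>Rays, cylinders and energy\<close>

text \<open>A first step towards the parent would return to the vertex before, which injectivity
  forbids; the root has no parent.\<close>

lemma boundary_step:
  assumes "x \<in> boundary \<Gamma>"
  shows "\<exists>i. x (Suc n) = x n @ [i]"
proof (induction n)
  case 0
  have "adjacent (x 0) (x (Suc 0))" "x 0 = []"
    using assms unfolding boundary_def by blast+
  then show ?case by (auto simp: adjacent_def)
next
  case (Suc n)
  then obtain i where i: "x (Suc n) = x n @ [i]" by blast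
  have "x (Suc (Suc n)) \<noteq> x n"
    using assms by (auto simp: boundary_def dest: injD)
  moreover have "adjacent (x (Suc n)) (x (Suc (Suc n)))" using assms by (auto simp: boundary_def)
  ultimately show ?case using i by (auto simp: adjacent_def)
qed

lemma boundary_length:
  assumes "x \<in> boundary \<Gamma>"
  shows "length (x n) = n"
proof (induction n)
  case (Suc n)
  then show ?case using boundary_step[OF assms, of n] by auto
qed (use assms in \<open>simp add: boundary_def\<close>)

lemma boundary_take:
  assumes "x \<in> boundary \<Gamma>" "n \<le> k"
  shows "x n = take n (x k)"
  using assms(2)
proof (induction k rule: dec_induct)
  case base
  then show ?case by (simp add: boundary_length[OF assms(1)])
next
  case (step k)
  then show ?case using boundary_step[OF assms(1), of k] boundary_length[OF assms(1), of k] by auto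
qed

lemma boundary_agree_mono:
  assumes "x \<in> boundary \<Gamma>" "y \<in> boundary \<Gamma>" "x k = y k" "n \<le> k"
  shows "x n = y n"
  using boundary_take[OF assms(1,4)] boundary_take[OF assms(2,4)] assms(3) by simp

lemma boundary_in_level: "x \<in> boundary \<Gamma> \<Longrightarrow> x n \<in> level \<Gamma> n"
  by (auto simp: level_def boundary_length) (auto simp: boundary_def)

text \<open>Rays that agree at an index agree at all earlier ones. A vertex has its length as index
  on every ray, so the lengths of the common vertices are exactly the indices of agreement.\<close>

lemma meet_eq_enat:
  assumes x: "x \<in> boundary \<Gamma>" and y: "y \<in> boundary \<Gamma>" and "x \<noteq> y"
  obtains k where "meet x y = enat k" "\<And>n. x n = y n \<longleftrightarrow> n \<le> k"
proof -
  let ?S = "{n. x n = y n}"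
  obtain j where j: "x j \<noteq> y j" using \<open>x \<noteq> y\<close> by auto
  have "n < j" if "x n = y n" for n
    using boundary_agree_mono[OF x y that, of j] j by (metis not_less)
  then have fin: "finite ?S" by (auto intro: finite_subset[of _ "{..<j}"])
  have "x 0 = y 0" using x y by (simp add: boundary_def)
  then have ne: "?S \<noteq> {}" by auto
  have iff: "x n = y n \<longleftrightarrow> n \<le> Max ?S" for n
    using Max_ge[OF fin, of n] Max_in[OF fin ne] boundary_agree_mono[OF x y, of "Max ?S" n] by auto
  have "length ` (range x \<inter> range y) = ?S"
  proof (intro set_eqI iffI)
    fix n assume "n \<in> length ` (range x \<inter> range y)"
    then show "n \<in> ?S" by (auto simp: boundary_length[OF x]) (metis boundary_length[OF x] boundary_length[OF y])
  next
    fix n assume "n \<in> ?S"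
    then have "x n \<in> range y" by simp
    then have "x n \<in> range x \<inter> range y" by simp
    from imageI[OF this, of length] show "n \<in> length ` (range x \<inter> range y)"
      by (simp only: boundary_length[OF x])
  qed
  then have "meet x y = enat (Max ?S)" using \<open>x \<noteq> y\<close> by (simp add: meet_def)
  then show ?thesis using iff that by blast
qed

text \<open>The value \<open>f 0\<close> at index 0 makes the partial sums up to and including
  \<open>n\<close> equal to \<open>f n\<close>.\<close>

definition gauge_increment :: "(nat \<Rightarrow> real) \<Rightarrow> nat \<Rightarrow> real" where
  "gauge_increment f n = (case n of 0 \<Rightarrow> f 0 | Suc k \<Rightarrow> f (Suc k) - f k)"

lemma gauge_increment_nonneg: "gauge_function f \<Longrightarrow> mono f \<Longrightarrow> 0 \<le> gauge_increment f n"
  by (cases n) (auto simp: gauge_increment_def gauge_function_def less_imp_le mono_iff_le_Suc)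

lemma sum_gauge_increment: "(\<Sum>k\<le>n. gauge_increment f k) = f n"
  by (induction n) (simp_all add: gauge_increment_def)

text \<open>Summation by parts: distinct rays collect the increments up to their meeting level,
  while equal rays collect the whole series, whose sum is the limit of \<open>f\<close>.\<close>

lemma gauge_ext_meet:
  assumes f: "gauge_function f" "mono f" and x: "x \<in> boundary \<Gamma>" and y: "y \<in> boundary \<Gamma>"
  shows "gauge_ext f (meet x y) = (\<Sum>n. ennreal (gauge_increment f n) * of_bool (x n = y n))"
proof (cases "x = y")
  case True
  have "(\<lambda>n. \<Sum>k\<le>n. ennreal (gauge_increment f k)) \<longlonglongrightarrow> (\<Sum>n. ennreal (gauge_increment f n))"
    by (rule summable_LIMSEQ') simp
  then have "(\<lambda>n. ennreal (f n)) \<longlonglongrightarrow> (\<Sum>n. ennreal (gauge_increment f n))"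
    using f by (simp add: sum_ennreal gauge_increment_nonneg sum_gauge_increment)
  then show ?thesis using True by (simp add: meet_def gauge_ext_def limI)
next
  case False
  obtain k where k: "meet x y = enat k" "\<And>n. x n = y n \<longleftrightarrow> n \<le> k"
    using meet_eq_enat[OF x y False] by blast
  have "(\<Sum>n. ennreal (gauge_increment f n) * of_bool (x n = y n))
      = (\<Sum>n\<le>k. ennreal (gauge_increment f n) * of_bool (x n = y n))"
    by (rule suminf_finite) (auto simp: k(2))
  also have "\<dots> = (\<Sum>n\<le>k. ennreal (gauge_increment f n))"
    by (rule sum.cong) (auto simp: k(2))
  also have "\<dots> = ennreal (f k)"
    using f by (simp add: sum_ennreal gauge_increment_nonneg sum_gauge_increment)
  finally show ?thesis by (simp add: k(1) gauge_ext_def)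
qed

section \<open>Cylinders and the energy formula\<close>

definition cylinder :: "nat list set \<Rightarrow> nat list \<Rightarrow> (nat \<Rightarrow> nat list) set" where
  "cylinder \<Gamma> v = {x \<in> boundary \<Gamma>. x (length v) = v}"

lemma openin_boundary_subset: "openin (boundary_topology \<Gamma>) U \<Longrightarrow> U \<subseteq> boundary \<Gamma>"
  using openin_subset[of "boundary_topology \<Gamma>" U] by (simp add: boundary_topology_def)

lemma space_boundary_borel: "space (boundary_borel \<Gamma>) = boundary \<Gamma>"
  unfolding boundary_borel_def by (rule space_measure_of) (use openin_boundary_subset in blast)

lemma openin_cylinder: "openin (boundary_topology \<Gamma>) (cylinder \<Gamma> v)"
proof -
  let ?T = "product_topology (\<lambda>_::nat. discrete_topology (UNIV :: nat list set)) UNIV"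
  have "continuous_map ?T (discrete_topology UNIV) (\<lambda>x. x (length v))"
    by (rule continuous_map_product_projection) simp
  then have "openin ?T {x \<in> topspace ?T. x (length v) \<in> {v}}"
    by (rule openin_continuous_map_preimage) simp
  then have "openin ?T {x. x (length v) = v}" by simp
  moreover have "cylinder \<Gamma> v = {x. x (length v) = v} \<inter> boundary \<Gamma>" by (auto simp: cylinder_def)
  ultimately show ?thesis unfolding boundary_topology_def openin_subtopology by blast
qed

lemma sets_cylinder [measurable]: "cylinder \<Gamma> v \<in> sets (boundary_borel \<Gamma>)"
  unfolding boundary_borel_def
  by (subst sets_measure_of) (use openin_boundary_subset openin_cylinder in blast)+

text \<open>A basic open set restricts finitely many coordinates, and agreement at the largest of
  them forces agreement at all of them.\<close>

lemma cylinder_nhd: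
  assumes U: "openin (boundary_topology \<Gamma>) U" and x: "x \<in> U"
  shows "\<exists>n. cylinder \<Gamma> (x n) \<subseteq> U"
proof -
  let ?T = "product_topology (\<lambda>_::nat. discrete_topology (UNIV :: nat list set)) UNIV"
  have xb: "x \<in> boundary \<Gamma>" using openin_boundary_subset[OF U] x by auto
  obtain V where V: "openin ?T V" "U = V \<inter> boundary \<Gamma>"
    using U by (auto simp: boundary_topology_def openin_subtopology)
  then obtain A where A: "finite {i. A i \<noteq> UNIV}" "x \<in> Pi\<^sub>E UNIV A" "Pi\<^sub>E UNIV A \<subseteq> V"
    using x unfolding openin_product_topology_alt by fastforce
  define n where "n = Max (insert 0 {i. A i \<noteq> UNIV})"
  have n: "i \<le> n" if "A i \<noteq> UNIV" for i
    unfolding n_def using A(1) that by (intro Max_ge) auto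
  have "y \<in> U" if y: "y \<in> cylinder \<Gamma> (x n)" for y
  proof -
    have yb: "y \<in> boundary \<Gamma>" and yn: "y n = x n"
      using y boundary_length[OF xb] by (auto simp: cylinder_def)
    have "y i \<in> A i" for i
    proof (cases "A i = UNIV")
      case False
      then have "y i = x i" using boundary_agree_mono[OF yb xb yn] n by auto
      then show ?thesis using A(2) by auto
    qed auto
    then have "y \<in> Pi\<^sub>E UNIV A" by auto
    then show ?thesis using A(3) V(2) yb by auto
  qed
  then show ?thesis by blast
qed

text \<open>Two rays agree at index \<open>n\<close> iff they lie in a common cylinder of level
  \<open>n\<close>. Inserting this into \<open>gauge_ext_meet\<close> separates the variables, and
  sums and integrals of non-negative terms may be exchanged.\<close>

lemma energy_eq:
  assumes f: "gauge_function f" "mono f" and fin: "\<And>n. finite (level \<Gamma> n)"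
    and sets: "sets \<theta> = sets (boundary_borel \<Gamma>)"
  shows "energy f \<theta> = (\<Sum>n. ennreal (gauge_increment f n) *
    (\<Sum>v\<in>level \<Gamma> n. emeasure \<theta> (cylinder \<Gamma> v) * emeasure \<theta> (cylinder \<Gamma> v)))"
proof -
  have sp: "space \<theta> = boundary \<Gamma>"
    using sets_eq_imp_space_eq[OF sets] by (simp add: space_boundary_borel)
  have [measurable]: "cylinder \<Gamma> v \<in> sets \<theta>" for v by (simp add: sets)
  let ?d = "\<lambda>n. ennreal (gauge_increment f n)"
  let ?I = "\<lambda>v. indicator (cylinder \<Gamma> v) :: _ \<Rightarrow> ennreal"
  have eq: "gauge_ext f (meet x y) = (\<Sum>n. ?d n * (\<Sum>v\<in>level \<Gamma> n. ?I v x * ?I v y))"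
    if x: "x \<in> boundary \<Gamma>" and y: "y \<in> boundary \<Gamma>" for x y
  proof -
    have "of_bool (x n = y n) = (\<Sum>v\<in>level \<Gamma> n. ?I v x * ?I v y)" for n
    proof -
      have "(\<Sum>v\<in>level \<Gamma> n. ?I v x * ?I v y) = (\<Sum>v\<in>level \<Gamma> n. if v = x n then of_bool (x n = y n) else 0)"
        using x y by (intro sum.cong refl) (auto simp: cylinder_def level_def indicator_def)
      then show ?thesis using boundary_in_level[OF x] fin by (simp add: sum.delta)
    qed
    then show ?thesis using gauge_ext_meet[OF f x y] by simp
  qed
  have "energy f \<theta> = (\<integral>\<^sup>+ x. (\<integral>\<^sup>+ y. (\<Sum>n. ?d n * (\<Sum>v\<in>level \<Gamma> n. ?I v x * ?I v y)) \<partial>\<theta>) \<partial>\<theta>)"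
    unfolding energy_def by (intro nn_integral_cong) (simp add: sp eq)
  also have "\<dots> = (\<integral>\<^sup>+ x. (\<Sum>n. ?d n * (\<Sum>v\<in>level \<Gamma> n. ?I v x * emeasure \<theta> (cylinder \<Gamma> v))) \<partial>\<theta>)"
    by (intro nn_integral_cong)
      (simp add: nn_integral_suminf nn_integral_cmult nn_integral_sum)
  also have "\<dots> = (\<Sum>n. ?d n * (\<Sum>v\<in>level \<Gamma> n. emeasure \<theta> (cylinder \<Gamma> v) * emeasure \<theta> (cylinder \<Gamma> v)))"
    by (simp add: nn_integral_suminf nn_integral_cmult nn_integral_sum nn_integral_multc)
  finally show ?thesis .
qed

text \<open>Increments are at most the values of \<open>f\<close>. Conversely,
  \<open>f n / m ^ n\<close> is the Cauchy product of the weighted increments with the geometric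
  series of ratio \<open>1 / m\<close>.\<close>

lemma summable_gauge_increment_iff:
  fixes m :: real
  assumes f: "gauge_function f" "mono f" and m: "1 < m"
  shows "summable (\<lambda>n. gauge_increment f n / m ^ n) \<longleftrightarrow> summable (\<lambda>n. f n / m ^ n)"
proof
  let ?d = "gauge_increment f"
  assume "summable (\<lambda>n. f n / m ^ n)"
  then show "summable (\<lambda>n. ?d n / m ^ n)"
  proof (rule summable_comparison_test'[where N = 0])
    fix n
    have "?d n \<le> f n"
      using f(1) by (auto simp: gauge_increment_def gauge_function_def less_imp_le split: nat.split)
    then show "norm (?d n / m ^ n) \<le> f n / m ^ n"
      using m gauge_increment_nonneg[OF f, of n] by (simp add: divide_right_mono)
  qed
next
  let ?d = "gauge_increment f"
  assume s: "summable (\<lambda>n. ?d n / m ^ n)"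
  have "summable (\<lambda>n. \<Sum>k\<le>n. (?d k / m ^ k) * (1 / m) ^ (n - k))"
    by (rule summable_Cauchy_product)
      (use s m gauge_increment_nonneg[OF f] in \<open>auto intro!: summable_geometric simp: power_abs abs_mult\<close>)
  also have "(\<lambda>n. \<Sum>k\<le>n. (?d k / m ^ k) * (1 / m) ^ (n - k)) = (\<lambda>n. f n / m ^ n)"
  proof
    fix n
    have "(\<Sum>k\<le>n. (?d k / m ^ k) * (1 / m) ^ (n - k)) = (\<Sum>k\<le>n. ?d k / m ^ n)"
      using m by (intro sum.cong refl) (simp add: power_one_over field_simps flip: power_add)
    then show "(\<Sum>k\<le>n. (?d k / m ^ k) * (1 / m) ^ (n - k)) = f n / m ^ n"
      by (simp add: sum_divide_distrib[symmetric] sum_gauge_increment)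
  qed
  finally show "summable (\<lambda>n. f n / m ^ n)" .
qed

lemma summable_of_capacity_pos:
  assumes m: "1 < m" and f: "gauge_function f" "mono f"
    and fin: "\<And>n. finite (level \<Gamma> n)" and card: "\<And>n. real (card (level \<Gamma> n)) \<le> C * m ^ n"
    and cap: "capacity f \<Gamma> > 0"
  shows "summable (\<lambda>n. f n / m ^ n)"
proof -
  have "(INF \<theta>\<in>{\<theta>. prob_space \<theta> \<and> sets \<theta> = sets (boundary_borel \<Gamma>)}. energy f \<theta>) < \<infinity>"
    using cap unfolding capacity_def ennreal_inverse_positive by (simp only: less_top infinity_ennreal_def)
  then obtain \<theta> where \<theta>: "prob_space \<theta>" and sets: "sets \<theta> = sets (boundary_borel \<Gamma>)"
    and en: "energy f \<theta> < \<infinity>"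
    unfolding INF_less_iff by blast
  interpret prob_space \<theta> by fact
  have sp: "space \<theta> = boundary \<Gamma>"
    using sets_eq_imp_space_eq[OF sets] by (simp add: space_boundary_borel)
  have [measurable]: "cylinder \<Gamma> v \<in> sets \<theta>" for v by (simp add: sets)
  let ?d = "gauge_increment f"
  define s where "s n = (\<Sum>v\<in>level \<Gamma> n. (prob (cylinder \<Gamma> v))\<^sup>2)" for n
  have s0: "0 \<le> s n" for n by (simp add: s_def sum_nonneg)
  have s: "1 \<le> s n * (C * m ^ n)" for n
  proof -
    have "x \<in> boundary \<Gamma> \<longleftrightarrow> (\<exists>v\<in>level \<Gamma> n. x \<in> cylinder \<Gamma> v)" for x
      using boundary_in_level[of x \<Gamma> n] boundary_length[of x \<Gamma> n]
      by (auto simp: cylinder_def intro!: bexI[of _ "x n"])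
    then have "boundary \<Gamma> = (\<Union>v\<in>level \<Gamma> n. cylinder \<Gamma> v)"
      by (intro set_eqI) (simp only: UN_iff)
    moreover have "disjoint_family_on (cylinder \<Gamma>) (level \<Gamma> n)"
      by (auto simp: disjoint_family_on_def cylinder_def level_def)
    ultimately have "prob (boundary \<Gamma>) = (\<Sum>v\<in>level \<Gamma> n. prob (cylinder \<Gamma> v))"
      using finite_measure_finite_Union[of "level \<Gamma> n" "cylinder \<Gamma>"] fin by (simp add: image_subset_iff)
    then have "(\<Sum>v\<in>level \<Gamma> n. prob (cylinder \<Gamma> v)) = prob (boundary \<Gamma>)" ..
    also have "\<dots> = 1" using prob_space sp by simp
    \<comment> \<open>Cauchy--Schwarz for the cylinder masses, whose sum over the level is
      1.\<close>
    finally have "1 \<le> s n * real (card (level \<Gamma> n))"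
      using sum_squared_le_sum_of_squares[of "\<lambda>v. prob (cylinder \<Gamma> v)" "level \<Gamma> n"] fin
      by (simp add: s_def)
    also have "\<dots> \<le> s n * (C * m ^ n)" by (rule mult_left_mono[OF card s0])
    finally show ?thesis .
  qed
  have "ennreal (s n) = (\<Sum>v\<in>level \<Gamma> n. emeasure \<theta> (cylinder \<Gamma> v) * emeasure \<theta> (cylinder \<Gamma> v))" for n
    unfolding s_def
    by (simp add: power2_eq_square emeasure_eq_measure flip: ennreal_mult')
  then have "(\<Sum>n. ennreal (?d n * s n)) = energy f \<theta>"
    unfolding energy_eq[OF f fin sets]
    by (simp add: ennreal_mult gauge_increment_nonneg[OF f] s0)
  then have sum: "summable (\<lambda>n. ?d n * s n)"
    using en gauge_increment_nonneg[OF f] s0 by (intro summable_suminf_not_top) auto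
  have "summable (\<lambda>n. C * (?d n * s n))" using sum by (rule summable_mult)
  then have "summable (\<lambda>n. ?d n / m ^ n)"
  proof (rule summable_comparison_test'[where N = 0])
    fix n
    have "?d n * 1 \<le> ?d n * (s n * (C * m ^ n))"
      using s gauge_increment_nonneg[OF f] by (intro mult_left_mono) auto
    then show "norm (?d n / m ^ n) \<le> C * (?d n * s n)"
      using m gauge_increment_nonneg[OF f, of n] by (simp add: divide_le_eq mult.assoc mult.left_commute)
  qed
  then show ?thesis using summable_gauge_increment_iff[OF f m] by simp
qed


section \<open>The measure of a flow\<close>

text \<open>
  A non-negative flow of total mass 1 subdivides \<open>[0, 1)\<close> into nested intervals, one for each
  vertex, of length the flow at the vertex; the measure of the flow is the law of the ray of
  intervals that contain a uniform random point.
\<close>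

definition left_end :: "(nat list \<Rightarrow> real) \<Rightarrow> nat list \<Rightarrow> real" where
  "left_end w v = (\<Sum>k<length v. \<Sum>j<v ! k. w (take k v @ [j]))"

definition cell :: "(nat list \<Rightarrow> real) \<Rightarrow> nat list \<Rightarrow> real set" where
  "cell w v = {left_end w v ..< left_end w v + w v}"

text \<open>The next vertex is the first child whose interval ends beyond \<open>r\<close>. For
  \<open>r\<close> in [0, 1) and a unit flow this passes over children with empty intervals.\<close>

primrec ray :: "(nat list \<Rightarrow> real) \<Rightarrow> real \<Rightarrow> nat \<Rightarrow> nat list" where
  "ray w r 0 = []"
| "ray w r (Suc n) = ray w r n @
     [LEAST i. r < left_end w (ray w r n @ [i]) + w (ray w r n @ [i])]"

lemma left_end_snoc: "left_end w (v @ [i]) = left_end w v + (\<Sum>j<i. w (v @ [j]))"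
  by (simp add: left_end_def nth_append)

lemma right_end_snoc: "left_end w (v @ [i]) + w (v @ [i]) = left_end w v + (\<Sum>j\<le>i. w (v @ [j]))"
  by (simp add: left_end_snoc flip: lessThan_Suc_atMost)

lemma length_ray [simp]: "length (ray w r n) = n"
  by (induction n) simp_all

locale unit_flow =
  fixes \<Gamma> :: "nat list set" and w :: "nat list \<Rightarrow> real"
  assumes rooted: "rooted_tree \<Gamma>" and unit: "w [] = 1"
    and nonneg: "\<And>v. v \<in> \<Gamma> \<Longrightarrow> 0 \<le> w v"
    and flow: "\<And>v. v \<in> \<Gamma> \<Longrightarrow> w v = (\<Sum>i<num_children \<Gamma> v. w (v @ [i]))"
begin

text \<open>By conservation of the flow, the interval of the last child ends where that of its
  parent does, so the \<open>LEAST\<close> is attained at a child. Its minimality gives the lower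
  bound, as each interval starts where the preceding sibling's ends.\<close>

lemma ray_in_cell:
  assumes r: "r \<in> {0..<1}"
  shows "ray w r n \<in> \<Gamma> \<and> r \<in> cell w (ray w r n)"
proof (induction n)
  case 0
  then show ?case
    using r unit rooted by (simp add: cell_def left_end_def rooted_tree_def)
next
  case (Suc n)
  let ?v = "ray w r n"
  let ?P = "\<lambda>i. r < left_end w (?v @ [i]) + w (?v @ [i])"
  define i where "i = (LEAST i. ?P i)"
  let ?N = "num_children \<Gamma> ?v"
  from Suc have v: "?v \<in> \<Gamma>" and lo: "left_end w ?v \<le> r" and hi: "r < left_end w ?v + w ?v"
    by (auto simp: cell_def)
  have "?N \<noteq> 0" using flow[OF v] lo hi by (intro notI) simp
  then have "?P (?N - 1)"
    using hi flow[OF v] by (simp add: right_end_snoc flip: lessThan_Suc_atMost)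
  then have Pi: "?P i" and "i \<le> ?N - 1" unfolding i_def by (rule LeastI, rule Least_le)
  then have i: "i < ?N" using \<open>?N \<noteq> 0\<close> by simp
  have "left_end w (?v @ [i]) \<le> r"
  proof (cases i)
    case (Suc k)
    then have "\<not> ?P k" unfolding i_def using not_less_Least[of k ?P] by simp
    then have "left_end w ?v + (\<Sum>j\<le>k. w (?v @ [j])) \<le> r" by (simp only: right_end_snoc not_less)
    then show ?thesis by (simp only: Suc left_end_snoc lessThan_Suc_atMost)
  qed (use lo in \<open>simp add: left_end_snoc\<close>)
  with Pi i show ?case
    by (simp add: cell_def rooted_tree_child_iff[OF rooted] flip: i_def)
qed

lemma cell_snoc_subset:
  assumes "v @ [i] \<in> \<Gamma>"
  shows "cell w (v @ [i]) \<subseteq> cell w v"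
proof -
  have v: "v \<in> \<Gamma>" using assms rooted by (auto simp: rooted_tree_def)
  have i: "i < num_children \<Gamma> v"
    using assms rooted_tree_child_iff[OF rooted] by blast
  have w_nonneg: "0 \<le> w (v @ [j])" if "j < num_children \<Gamma> v" for j
    using that rooted_tree_child_iff[OF rooted] nonneg by blast
  have lo: "0 \<le> (\<Sum>j<i. w (v @ [j]))"
    using i by (intro sum_nonneg w_nonneg) simp
  have "(\<Sum>j\<le>i. w (v @ [j])) \<le> (\<Sum>j<num_children \<Gamma> v. w (v @ [j]))"
  proof (rule sum_mono2)
    show "{..i} \<subseteq> {..<num_children \<Gamma> v}" using i by auto
    show "0 \<le> w (v @ [j])" if "j \<in> {..<num_children \<Gamma> v} - {..i}" for j
      using that by (intro w_nonneg) simp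
  qed simp
  then have hi: "left_end w (v @ [i]) + w (v @ [i]) \<le> left_end w v + w v"
    unfolding right_end_snoc flow[OF v] by (rule add_left_mono)
  show ?thesis
  proof
    fix r assume "r \<in> cell w (v @ [i])"
    then have "left_end w (v @ [i]) \<le> r" "r < left_end w (v @ [i]) + w (v @ [i])"
      unfolding cell_def by simp_all
    then show "r \<in> cell w v" using lo hi by (simp add: cell_def left_end_snoc)
  qed
qed

text \<open>Intervals of earlier siblings end at or before the left end of this one, so none of them
  can be chosen by \<open>LEAST\<close>.\<close>

lemma ray_eq_of_in_cell:
  "v \<in> \<Gamma> \<Longrightarrow> r \<in> cell w v \<Longrightarrow> ray w r (length v) = v"
proof (induction v rule: rev_induct)
  case (snoc i v)
  have v: "v \<in> \<Gamma>" using snoc.prems rooted by (auto simp: rooted_tree_def)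
  have ray: "ray w r (length v) = v"
    using snoc.IH[OF v] cell_snoc_subset[OF snoc.prems(1)] snoc.prems(2) by auto
  have "(LEAST i. r < left_end w (v @ [i]) + w (v @ [i])) = i"
  proof (rule Least_equality)
    show "r < left_end w (v @ [i]) + w (v @ [i])" using snoc.prems(2) by (simp add: cell_def)
    fix j assume j: "r < left_end w (v @ [j]) + w (v @ [j])"
    show "i \<le> j"
    proof (rule ccontr)
      assume "\<not> i \<le> j"
      then have "{..j} \<subseteq> {..<i}" by auto
      moreover have "v @ [k] \<in> \<Gamma>" if "k < i" for k
        using snoc.prems(1) that rooted unfolding rooted_tree_def by blast
      ultimately have "(\<Sum>k\<le>j. w (v @ [k])) \<le> (\<Sum>k<i. w (v @ [k]))"
        by (intro sum_mono2 nonneg) auto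
      then have "left_end w (v @ [j]) + w (v @ [j]) \<le> left_end w (v @ [i])"
        unfolding right_end_snoc by (simp add: left_end_snoc)
      also have "\<dots> \<le> r" using snoc.prems(2) by (simp add: cell_def)
      finally show False using j by simp
    qed
  qed
  then show ?case by (simp add: ray)
qed simp

lemma ray_in_boundary:
  assumes "r \<in> {0..<1}"
  shows "ray w r \<in> boundary \<Gamma>"
proof -
  have "inj (ray w r)" by (rule injI) (metis length_ray)
  moreover have "adjacent (ray w r n) (ray w r (Suc n))" for n
    by (auto simp: adjacent_def)
  ultimately show ?thesis
    using ray_in_cell[OF assms] by (auto simp: boundary_def)
qed

lemma ray_in_cylinder_iff:
  assumes "r \<in> {0..<1}" "v \<in> \<Gamma>"
  shows "ray w r \<in> cylinder \<Gamma> v \<longleftrightarrow> r \<in> cell w v"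
proof
  assume "ray w r \<in> cylinder \<Gamma> v"
  then have "ray w r (length v) = v" by (simp add: cylinder_def)
  then show "r \<in> cell w v" using ray_in_cell[OF assms(1), of "length v"] by simp
next
  assume "r \<in> cell w v"
  then show "ray w r \<in> cylinder \<Gamma> v"
    using ray_in_boundary[OF assms(1)] ray_eq_of_in_cell[OF assms(2)] by (simp add: cylinder_def)
qed

definition flow_measure :: "(nat \<Rightarrow> nat list) measure" where
  "flow_measure = distr (restrict_space lborel {0..<1}) (boundary_borel \<Gamma>) (ray w)"

text \<open>An open set is the union of the cylinders inside it, of which there are countably many;
  the preimage of each is an interval intersected with [0, 1).\<close>

lemma measurable_ray: "ray w \<in> restrict_space lborel {0..<1} \<rightarrow>\<^sub>M boundary_borel \<Gamma>"
  unfolding boundary_borel_def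
proof (rule measurable_measure_of)
  fix U assume "U \<in> {U. openin (boundary_topology \<Gamma>) U}"
  then have U: "openin (boundary_topology \<Gamma>) U" by simp
  let ?V = "{v \<in> \<Gamma>. cylinder \<Gamma> v \<subseteq> U}"
  have "ray w r \<in> U \<longleftrightarrow> (\<exists>v\<in>?V. r \<in> cell w v)" if r: "r \<in> {0..<1}" for r
  proof
    assume rU: "ray w r \<in> U"
    obtain n where "cylinder \<Gamma> (ray w r n) \<subseteq> U" using cylinder_nhd[OF U rU] by blast
    then show "\<exists>v\<in>?V. r \<in> cell w v" using ray_in_cell[OF r, of n] by blast
  next
    assume "\<exists>v\<in>?V. r \<in> cell w v"
    then obtain v where "v \<in> \<Gamma>" "cylinder \<Gamma> v \<subseteq> U" "r \<in> cell w v" by blast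
    then show "ray w r \<in> U" using ray_in_cylinder_iff[OF r, of v] by blast
  qed
  then have "ray w -` U \<inter> space (restrict_space lborel {0..<1}) = {0..<1} \<inter> (\<Union>v\<in>?V. cell w v)"
    by (auto simp: space_restrict_space)
  also have "\<dots> \<in> sets (restrict_space lborel {0..<1})"
    by (subst sets_restrict_space_iff) (auto simp: cell_def intro!: sets.countable_UN')
  finally show "ray w -` U \<inter> space (restrict_space lborel {0..<1})
      \<in> sets (restrict_space lborel {0..<1})" .
qed (use openin_boundary_subset ray_in_boundary in \<open>auto simp: space_restrict_space\<close>)

lemma prob_space_flow_measure: "prob_space flow_measure"
  unfolding flow_measure_def
proof (rule prob_space.prob_space_distr[OF _ measurable_ray], rule prob_spaceI)
  show "emeasure (restrict_space lborel {0..<1 :: real}) (space (restrict_space lborel {0..<1})) = 1"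
    by (subst emeasure_restrict_space) (auto simp: space_restrict_space)
qed

lemma sets_flow_measure: "sets flow_measure = sets (boundary_borel \<Gamma>)"
  by (simp add: flow_measure_def)

text \<open>The preimage is the part of the cell inside [0, 1). The inequality, which bounds
  energies from above, follows without locating the cell.\<close>

lemma emeasure_flow_measure_cylinder:
  assumes v: "v \<in> \<Gamma>"
  shows "emeasure flow_measure (cylinder \<Gamma> v) \<le> ennreal (w v)"
proof -
  have "emeasure flow_measure (cylinder \<Gamma> v) = emeasure (restrict_space lborel {0..<1})
      (ray w -` cylinder \<Gamma> v \<inter> space (restrict_space lborel {0..<1}))"
    unfolding flow_measure_def by (rule emeasure_distr[OF measurable_ray sets_cylinder])
  also have "ray w -` cylinder \<Gamma> v \<inter> space (restrict_space lborel {0..<1}) = {0..<1} \<inter> cell w v"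
    using ray_in_cylinder_iff[OF _ v] by (auto simp: space_restrict_space)
  also have "emeasure (restrict_space lborel {0..<1}) \<dots> = emeasure lborel ({0..<1} \<inter> cell w v)"
    by (rule emeasure_restrict_space) auto
  also have "\<dots> \<le> emeasure lborel (cell w v)" by (rule emeasure_mono) (auto simp: cell_def)
  also have "\<dots> = ennreal (w v)" using nonneg[OF v] by (simp add: cell_def)
  finally show ?thesis .
qed

lemma capacity_pos:
  assumes m: "1 < m" and f: "gauge_function f" "mono f" and fin: "\<And>n. finite (level \<Gamma> n)"
    and square: "\<And>n. (\<Sum>v\<in>level \<Gamma> n. (w v)\<^sup>2) \<le> C / m ^ n"
    and sum: "summable (\<lambda>n. f n / m ^ n)"
  shows "capacity f \<Gamma> > 0"
proof -
  let ?d = "gauge_increment f"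
  have "level \<Gamma> 0 = {[]}" using rooted by (auto simp: level_def rooted_tree_def)
  then have C: "0 \<le> C" using square[of 0] by (simp add: unit)
  have "energy f flow_measure \<le> (\<Sum>n. ennreal (C * (?d n / m ^ n)))"
    unfolding energy_eq[OF f fin sets_flow_measure]
  proof (intro suminf_le summableI)
    fix n
    have "(\<Sum>v\<in>level \<Gamma> n. emeasure flow_measure (cylinder \<Gamma> v) * emeasure flow_measure (cylinder \<Gamma> v))
        \<le> (\<Sum>v\<in>level \<Gamma> n. ennreal (w v) * ennreal (w v))"
      by (intro sum_mono mult_mono emeasure_flow_measure_cylinder) (auto simp: level_def)
    also have "\<dots> = ennreal (\<Sum>v\<in>level \<Gamma> n. (w v)\<^sup>2)"
    proof -
      have "ennreal ((w v)\<^sup>2) = ennreal (w v) * ennreal (w v)" if "v \<in> level \<Gamma> n" for v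
        using that nonneg[of v] by (simp add: level_def power2_eq_square ennreal_mult')
      then show ?thesis by (simp flip: sum_ennreal)
    qed
    also have "\<dots> \<le> ennreal (C / m ^ n)" by (rule ennreal_leI[OF square])
    finally have "ennreal (?d n) * (\<Sum>v\<in>level \<Gamma> n. emeasure flow_measure (cylinder \<Gamma> v) *
        emeasure flow_measure (cylinder \<Gamma> v)) \<le> ennreal (?d n) * ennreal (C / m ^ n)"
      by (rule mult_left_mono) simp
    also have "\<dots> = ennreal (C * (?d n / m ^ n))"
      using gauge_increment_nonneg[OF f, of n] by (simp add: mult.commute flip: ennreal_mult')
    finally show "ennreal (?d n) * (\<Sum>v\<in>level \<Gamma> n. emeasure flow_measure (cylinder \<Gamma> v) *
        emeasure flow_measure (cylinder \<Gamma> v)) \<le> ennreal (C * (?d n / m ^ n))" .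
  qed
  also have "\<dots> < \<infinity>"
  proof -
    have "summable (\<lambda>n. C * (?d n / m ^ n))"
      using sum summable_gauge_increment_iff[OF f m] by (intro summable_mult) simp
    moreover have "0 \<le> C * (?d n / m ^ n)" for n
      using C m gauge_increment_nonneg[OF f, of n] by simp
    ultimately show ?thesis by (subst suminf_ennreal2) auto
  qed
  finally have "energy f flow_measure < \<infinity>" .
  then have "(INF \<theta>\<in>{\<theta>. prob_space \<theta> \<and> sets \<theta> = sets (boundary_borel \<Gamma>)}. energy f \<theta>) < \<infinity>"
    unfolding INF_less_iff using prob_space_flow_measure sets_flow_measure by blast
  then show ?thesis
    unfolding capacity_def ennreal_inverse_positive by (simp only: less_top infinity_ennreal_def)
qed

end

text \<open>Dividing the flow by its strength \<open>w []\<close> gives a unit flow, at the cost of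
  dividing \<open>C\<close> by the square of the strength.\<close>

lemma capacity_pos_of_tame_flow:
  assumes \<Gamma>: "rooted_tree \<Gamma>" and m: "1 < m" and f: "gauge_function f" "mono f"
    and fin: "\<And>n. finite (level \<Gamma> n)" and w: "tame_flow m \<Gamma> w C"
    and sum: "summable (\<lambda>n. f n / m ^ n)"
  shows "capacity f \<Gamma> > 0"
proof -
  define u where "u v = w v / w []" for v
  have w0: "0 < w []" using w by (simp add: tame_flow_def)
  interpret unit_flow \<Gamma> u
  proof
    fix v assume v: "v \<in> \<Gamma>"
    have "0 \<le> w v" using w v unfolding tame_flow_def by blast
    then show "0 \<le> u v" using w0 by (simp add: u_def)
    have "w v = (\<Sum>i<num_children \<Gamma> v. w (v @ [i]))" using w v unfolding tame_flow_def by blast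
    then show "u v = (\<Sum>i<num_children \<Gamma> v. u (v @ [i]))"
      unfolding u_def by (simp flip: sum_divide_distrib)
  qed (use w0 \<Gamma> in \<open>auto simp: u_def\<close>)
  show ?thesis
  proof (rule capacity_pos[OF m f fin _ sum])
    fix n
    have "(\<Sum>v\<in>level \<Gamma> n. (w v)\<^sup>2) / (w [])\<^sup>2 \<le> C / m ^ n / (w [])\<^sup>2"
      using w by (intro divide_right_mono) (auto simp: tame_flow_def)
    then show "(\<Sum>v\<in>level \<Gamma> n. (u v)\<^sup>2) \<le> C / (w [])\<^sup>2 / m ^ n"
      by (simp add: u_def power_divide sum_divide_distrib mult.commute)
  qed
qed

theorem theorem4p1:
  fixes q :: "nat pmf" and m :: real
  assumes mean_finite: "integrable (measure_pmf q) real"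
    and mean: "m = measure_pmf.expectation q real"
    and variance_finite: "integrable (measure_pmf q) (\<lambda>n. (real n - m)\<^sup>2)"
    and q0: "pmf q 0 = 0"
    and q1: "pmf q 1 \<noteq> 1"
  shows "AE \<Gamma> in galton_watson q.
           \<forall>f. gauge_function f \<longrightarrow> mono f \<longrightarrow>
             (capacity f \<Gamma> > 0 \<longleftrightarrow> summable (\<lambda>n. f (Suc n) / m ^ Suc n))"
proof -
  interpret offspring q m by standard (fact assms)+
  show ?thesis
    using AE_tame_flow
  proof eventually_elim
    case (elim \<Gamma>)
    then obtain C w where \<Gamma>: "rooted_tree \<Gamma>" and w: "tame_flow m \<Gamma> w C"
      and level: "\<forall>n. finite (level \<Gamma> n) \<and> real (card (level \<Gamma> n)) \<le> C * m ^ n"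
      by blast
    from level have fin: "\<And>n. finite (level \<Gamma> n)"
      and card: "\<And>n. real (card (level \<Gamma> n)) \<le> C * m ^ n" by auto
    show ?case
    proof (intro allI impI)
      fix f assume f: "gauge_function f" "mono f"
      have "capacity f \<Gamma> > 0 \<longleftrightarrow> summable (\<lambda>n. f n / m ^ n)"
        using summable_of_capacity_pos[OF mean_gt_1 f fin card]
          capacity_pos_of_tame_flow[OF \<Gamma> mean_gt_1 f fin w] by blast
      \<comment> \<open>The series in the statement starts at 1; the term at 0 does not affect
        convergence.\<close>
      also have "\<dots> \<longleftrightarrow> summable (\<lambda>n. f (Suc n) / m ^ Suc n)"
        by (rule summable_Suc_iff[symmetric])
      finally show "capacity f \<Gamma> > 0 \<longleftrightarrow> summable (\<lambda>n. f (Suc n) / m ^ Suc n)" .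
    qed
  qed
qed

end
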